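(* Let $\lambda_0,\dots,\lambda_n\in\mathbb{C}$ ($n\ge1$) with $\lambda_0,\lambda_1$ real and $\lambda_0<\lambda_1$. Suppose $E_{(\lambda_0,\dots,\lambda_n)}$ is closed under complex conjugation and $0<b-a<\pi/M_n$, where $M_n:=\max\{|\mathrm{Im}\,\lambda_j|:j=0,\dots,n\}$ (no restriction if $M_n=0$). Define points $t_0,\dots,t_n$ by $t_0=a$ and, for $k=1,\dots,n$, $$e^{(\lambda_0-\lambda_1)(t_k-t_{k-1})}=\lim_{x\to b}\frac{p_{(\lambda_0,\lambda_2,\dots,\lambda_n),k-1}(x)}{p_{(\lambda_1,\dots,\lambda_n),k-1}(x)}$$ (the right-hand side is a positive real number). Then $a=t_0<t_1<\dots<t_n=b$. Put $\alpha_0=1$ and, for $k=1,\dots,n$, $$\alpha_k=e^{-\lambda_0(t_k-a)}(-1)^k\prod_{l=0}^{k-1}\lim_{x\to b}\frac{\frac{d}{dx}p_{(\lambda_0,\dots,\lambda_n),l}(x)}{p_{(\lambda_1,\dots,\lambda_n),l}(x)}.$$ Then $\alpha_0,\dots,\alpha_n>0$, and the operator $B_{(\lambda_0,\dots,\lambda_n)}$ on $C[a,b]$ defined by $B_{(\lambda_0,\dots,\lambda_n)}f=\sum_{k=0}^n\alpha_kf(t_k)\,p_{(\lambda_0,\dots,\lambda_n),k}$ satisfies $B_{(\lambda_0,\dots,\lambda_n)}(e^{\lambda_0x})=e^{\lambda_0x}$ and $B_{(\lambda_0,\dots,\lambda_n)}(e^{\lambda_1x})=e^{\lambda_1x}$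 on $[a,b]$. Moreover, these are the only real numbers $t_0,\dots,t_n$ and $\alpha_0,\dots,\alpha_n$ for which the operator $f\mapsto\sum_{k=0}^n\alpha_kf(t_k)p_{(\lambda_0,\dots,\lambda_n),k}$ fixes both $e^{\lambda_0x}$ and $e^{\lambda_1x}$.
   Context: $E_{(\mu_0,\dots,\mu_m)}$ denotes the space of all $f\in C^\infty(\mathbb{R},\mathbb{C})$ with $(\frac{d}{dx}-\mu_0)\cdots(\frac{d}{dx}-\mu_m)f=0$ (dimension $m+1$, independent of the order of the $\mu_j$); it is closed under complex conjugation if $\overline f$ lies in it whenever $f$ does. A zero of order (exactly) $k$ at $a$ means $f(a)=\dots=f^{(k-1)}(a)=0$, $f^{(k)}(a)\neq0$. The space is an extended Chebyshev system over $A\subset\mathbb{R}$ if every nonzero element has at most $m$ zeros in $A$ counted with multiplicity; under the hypotheses here the spaces $E_{(\lambda_0,\dots,\lambda_n)}$, $E_{(\lambda_0,\lambda_2,\dots,\lambda_n)}$, $E_{(\lambda_1,\dots,\lambda_n)}$ are extended Chebyshev systems over $[a,b]$. For such a space and $a\ne b$, the Bernstein basis $p_{(\mu_0,\dots,\mu_m),k}$, $k=0,\dots,m$, is the unique family in the space with $p_{(\mu_0,\dots,\mu_m),k}$ having a zero of order exactly $k$ at $a$, exactly $m-k$ at $b$, and $p^{(k)}_{(\mu_0,\dots,\mu_m),k}(a)=1$. *)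

theory Defs
  imports "HOL-Analysis.Analysis"
begin

definition Dx :: "(real \<Rightarrow> complex) \<Rightarrow> real \<Rightarrow> complex" where
  "Dx f = (\<lambda>x. vector_derivative f (at x))"

fun Dn :: "nat \<Rightarrow> (real \<Rightarrow> complex) \<Rightarrow> real \<Rightarrow> complex" where
  "Dn 0 f = f"
| "Dn (Suc k) f = Dx (Dn k f)"

definition smooth :: "(real \<Rightarrow> complex) \<Rightarrow> bool" where
  "smooth f \<longleftrightarrow> (\<forall>k x. Dn k f differentiable (at x))"

fun Lop :: "complex list \<Rightarrow> (real \<Rightarrow> complex) \<Rightarrow> real \<Rightarrow> complex" where
  "Lop [] f = f"
| "Lop (\<mu> # \<mu>s) f = (\<lambda>x. Dx (Lop \<mu>s f) x - \<mu> * Lop \<mu>s f x)"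

definition Espace :: "complex list \<Rightarrow> (real \<Rightarrow> complex) set" where
  "Espace \<mu>s = {f. smooth f \<and> Lop \<mu>s f = (\<lambda>_. 0)}"

definition closed_cnj :: "complex list \<Rightarrow> bool" where
  "closed_cnj \<mu>s \<longleftrightarrow> (\<forall>f\<in>Espace \<mu>s. (\<lambda>x. cnj (f x)) \<in> Espace \<mu>s)"

definition zero_order :: "(real \<Rightarrow> complex) \<Rightarrow> real \<Rightarrow> nat \<Rightarrow> bool" where
  "zero_order f a k \<longleftrightarrow> (\<forall>j<k. Dn j f a = 0) \<and> Dn k f a \<noteq> 0"

definition bern :: "complex list \<Rightarrow> real \<Rightarrow> real \<Rightarrow> nat \<Rightarrow> real \<Rightarrow> complex" where
  "bern \<mu>s a b k = (THE p. p \<in> Espace \<mu>s \<and> zero_order p a k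
       \<and> zero_order p b (length \<mu>s - 1 - k) \<and> Dn k p a = 1)"

end

theory Submission
  imports Defs
begin

text \<open>
  Zeros of elements of the spaces involved are counted by Rolle's theorem. A real exponent \<mu> costs
  one zero, because f' - \<mu> f is up to a positive factor the derivative of e^{-\<mu> x} f. A
  conjugate pair \<alpha> \<plusminus> i \<beta> costs two, because y'' + \<beta>^2 y = (w^2 (y/w)')' / w with
  w = cos (\<beta> (x - c)), and w is positive on [a,b] for the midpoint c precisely when
  \<beta> (b - a) < \<pi>. This gives the extended Chebyshev property, hence the Bernstein bases, their
  positivity on (a,b) and the signs of their leading Taylor coefficients at b.

  Write p_k, q_k, q~_k for the bases of (\<lambda>_0,...,\<lambda>_n), (\<lambda>_1,...,\<lambda>_n) and
  (\<lambda>_0,\<lambda>_2,...,\<lambda>_n). Comparing zeros, (D - \<lambda>_0) p_k = q_{k-1} + d_k q_k with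
  d_k = lim p_k'/q_k < 0, so the coefficients of e^{\<lambda>_0 x} satisfy c_{k+1} = -d_k c_k, and
  similarly for \<lambda>_1 with q~_k; this yields the formulas for t_k and \<alpha>_k. For t_{k-1} < t_k one
  needs lim q~_k/q_k < 1. Here q~_k - q_k = s p_{k+1}, while
  (D - \<lambda>_0) q~_k - (D - \<lambda>_1) q_k is the multiple s + \<lambda>_1 - \<lambda>_0 of the k-th basis function for
  (\<lambda>_2,...,\<lambda>_n); comparing signs at b forces s < 0.
\<close>

section \<open>Smooth functions and the spaces E\<close>

lemma smooth_has_vector_derivative:
  assumes "smooth f"
  shows "(Dn k f has_vector_derivative Dn (Suc k) f x) (at x)"
  using assms by (simp add: smooth_def Dx_def flip: vector_derivative_works)

lemma has_vector_derivative_imp_Dx: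
  assumes "\<And>x. (f has_vector_derivative g x) (at x)"
  shows "Dx f = g"
  using assms by (auto simp: Dx_def vector_derivative_at)

text \<open>A sequence in which each term is the derivative of its predecessor settles all iterated
  derivatives at once; with \<open>smoothI\<close>, the closure properties below reduce to
  exhibiting such a sequence.\<close>

lemma Dn_eqI:
  assumes "\<And>k x. (F k has_vector_derivative F (Suc k) x) (at x)"
  shows "Dn k (F 0) = F k"
  by (induction k) (auto intro!: has_vector_derivative_imp_Dx assms)

lemma smoothI:
  assumes "\<And>k x. (F k has_vector_derivative F (Suc k) x) (at x)"
  shows "smooth (F 0)"
  unfolding smooth_def Dn_eqI[of F, OF assms] using assms differentiableI_vector by blast

lemma Dn_Dx: "Dn k (Dx f) = Dn (Suc k) f"
  by (induction k) auto

lemma smooth_Dx: "smooth f \<Longrightarrow> smooth (Dx f)"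
  using smoothI[of "\<lambda>k. Dn (Suc k) f"] smooth_has_vector_derivative[of f "Suc _"] by simp

lemma smooth_lincomb:
  assumes "smooth f" "smooth g"
  shows "smooth (\<lambda>x. c * f x + d * g x)"
    and "Dn k (\<lambda>x. c * f x + d * g x) = (\<lambda>x. c * Dn k f x + d * Dn k g x)"
proof -
  define F where "F = (\<lambda>k x. c * Dn k f x + d * Dn k g x)"
  have F: "(F k has_vector_derivative F (Suc k) x) (at x)" for k x
    unfolding F_def
    by (intro has_vector_derivative_add has_vector_derivative_mult_right
        smooth_has_vector_derivative assms)
  show "smooth (\<lambda>x. c * f x + d * g x)" using smoothI[of F, OF F] by (simp add: F_def)
  show "Dn k (\<lambda>x. c * f x + d * g x) = (\<lambda>x. c * Dn k f x + d * Dn k g x)"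
    using Dn_eqI[of F, OF F] by (simp add: F_def)
qed

lemma smooth_zero: "smooth (\<lambda>_. 0)" and Dn_zero: "Dn k (\<lambda>_. 0) = (\<lambda>_. 0)"
  using smoothI[of "\<lambda>_ _. 0"] Dn_eqI[of "\<lambda>_ _. 0"] by auto

lemma smooth_scale:
  assumes "smooth f"
  shows "smooth (\<lambda>x. c * f x)" and "Dn k (\<lambda>x. c * f x) = (\<lambda>x. c * Dn k f x)"
  using smooth_lincomb[OF assms smooth_zero, where c = c and d = 0] by simp_all

lemma smooth_diff:
  assumes "smooth f" "smooth g"
  shows "smooth (\<lambda>x. f x - g x)" and "Dn k (\<lambda>x. f x - g x) = (\<lambda>x. Dn k f x - Dn k g x)"
  using smooth_lincomb[OF assms, where c = 1 and d = "-1"] by simp_all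

lemma smooth_sum:
  fixes p :: "nat \<Rightarrow> real \<Rightarrow> complex"
  assumes "\<And>i. i < m \<Longrightarrow> smooth (p i)"
  shows "smooth (\<lambda>x. \<Sum>i<m. c i * p i x)
    \<and> (\<forall>k. Dn k (\<lambda>x. \<Sum>i<m. c i * p i x) = (\<lambda>x. \<Sum>i<m. c i * Dn k (p i) x))"
  using assms
proof (induction m)
  case 0
  then show ?case by (simp add: smooth_zero Dn_zero)
next
  case (Suc m)
  then have IH: "smooth (\<lambda>x. \<Sum>i<m. c i * p i x)"
      "\<And>k. Dn k (\<lambda>x. \<Sum>i<m. c i * p i x) = (\<lambda>x. \<Sum>i<m. c i * Dn k (p i) x)" by auto
  show ?case
    using smooth_lincomb[OF IH(1) Suc.prems[OF lessI], where c = 1 and d = "c m"] IH(2) by simp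
qed

lemma smooth_cnj:
  assumes "smooth f"
  shows "smooth (\<lambda>x. cnj (f x))" and "Dn k (\<lambda>x. cnj (f x)) = (\<lambda>x. cnj (Dn k f x))"
proof -
  define F where "F = (\<lambda>k x. cnj (Dn k f x))"
  have F: "(F k has_vector_derivative F (Suc k) x) (at x)" for k x
    unfolding F_def
    by (intro has_vector_derivative_cnj smooth_has_vector_derivative assms)
  show "smooth (\<lambda>x. cnj (f x))" using smoothI[of F, OF F] by (simp add: F_def)
  show "Dn k (\<lambda>x. cnj (f x)) = (\<lambda>x. cnj (Dn k f x))"
    using Dn_eqI[of F, OF F] by (simp add: F_def)
qed

lemma has_vector_derivative_exp_mult:
  "((\<lambda>x. exp (\<mu> * complex_of_real x)) has_vector_derivative \<mu> * exp (\<mu> * complex_of_real x)) (at x)"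
proof -
  have "((\<lambda>z. exp (\<mu> * z)) has_field_derivative \<mu> * exp (\<mu> * z)) (at z)" for z
    by (auto intro!: derivative_eq_intros)
  from has_vector_derivative_real_field[OF this] show ?thesis by simp
qed

lemma smooth_exp: "smooth (\<lambda>x. exp (\<mu> * complex_of_real x))"
proof -
  define F where "F = (\<lambda>k x. \<mu> ^ k * exp (\<mu> * complex_of_real x))"
  have "(F k has_vector_derivative F (Suc k) x) (at x)" for k x
    unfolding F_def
    using has_vector_derivative_mult_right[OF has_vector_derivative_exp_mult, of "\<mu> ^ k" \<mu> x]
    by (simp add: mult_ac)
  from smoothI[of F, OF this] show ?thesis by (simp add: F_def)
qed

section \<open>First-order factors D - \<mu> and the spaces they annihilate\<close>

definition dl :: "complex \<Rightarrow> (real \<Rightarrow> complex) \<Rightarrow> real \<Rightarrow> complex" where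
  "dl \<mu> f = (\<lambda>x. Dx f x - \<mu> * f x)"

lemma Lop_Cons: "Lop (\<mu> # \<mu>s) f = dl \<mu> (Lop \<mu>s f)"
  by (simp add: dl_def)

lemma Lop_append: "Lop (xs @ ys) f = Lop xs (Lop ys f)"
  by (induction xs) auto

lemma smooth_dl:
  assumes "smooth f"
  shows "smooth (dl \<mu> f)" and "Dn k (dl \<mu> f) = (\<lambda>x. Dn (Suc k) f x - \<mu> * Dn k f x)"
  using smooth_lincomb[OF smooth_Dx[OF assms] assms, where c = 1 and d = "-\<mu>"]
  by (simp_all add: dl_def Dn_Dx del: Dn.simps(2))

lemma smooth_Lop: "smooth f \<Longrightarrow> smooth (Lop \<mu>s f)"
  by (induction \<mu>s) (auto simp: Lop_Cons smooth_dl simp del: Lop.simps(2))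

lemma dl_commute:
  assumes "smooth f"
  shows "dl \<mu> (dl \<nu> f) = dl \<nu> (dl \<mu> f)"
  using smooth_dl(2)[OF assms, of 1] unfolding dl_def[of _ "dl _ f"]
  by (simp add: dl_def algebra_simps)

lemma Lop_dl: "smooth f \<Longrightarrow> Lop \<mu>s (dl \<mu> f) = dl \<mu> (Lop \<mu>s f)"
  by (induction \<mu>s) (auto simp: Lop_Cons dl_commute smooth_Lop simp del: Lop.simps(2))

text \<open>Constant-coefficient factors commute, so any exponent may be carried to the head of the
  list; later arguments that peel off a chosen exponent rely on this.\<close>

lemma Lop_mset_cong:
  assumes "smooth f" "mset xs = mset ys"
  shows "Lop xs f = Lop ys f"
  using assms(2)
proof (induction xs arbitrary: ys)
  case Nil
  then show ?case by simp
next
  case (Cons x xs)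
  then have "x \<in> set ys" by (metis list.set_intros(1) set_mset_mset)
  then obtain us vs where ys: "ys = us @ x # vs" by (meson split_list)
  then have "mset xs = mset (us @ vs)" using Cons.prems by simp
  from Cons.IH[OF this] show ?case
    by (simp add: ys Lop_append Lop_Cons Lop_dl smooth_Lop assms(1) del: Lop.simps(2))
qed

lemma Espace_mset_cong: "mset xs = mset ys \<Longrightarrow> Espace xs = Espace ys"
  unfolding Espace_def using Lop_mset_cong[of _ xs ys] by (metis (mono_tags, lifting))

lemma Espace_smooth: "f \<in> Espace \<mu>s \<Longrightarrow> smooth f"
  by (simp add: Espace_def)

lemma Espace_Nil: "f \<in> Espace [] \<Longrightarrow> f = (\<lambda>_. 0)"
  by (simp add: Espace_def)

text \<open>\<open>Lop\<close> applies the head factor last; by commutation it can be applied first,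
  which trades one exponent for one application of \<open>dl\<close>.\<close>

lemma Espace_Cons_iff: "smooth f \<Longrightarrow> f \<in> Espace (\<mu> # \<mu>s) \<longleftrightarrow> dl \<mu> f \<in> Espace \<mu>s"
  by (simp add: Espace_def smooth_dl Lop_dl Lop_Cons del: Lop.simps(2))

lemma Espace_dl: "f \<in> Espace (\<mu> # \<mu>s) \<Longrightarrow> dl \<mu> f \<in> Espace \<mu>s"
  using Espace_Cons_iff Espace_smooth by blast

lemma dl_lincomb:
  assumes "smooth f" "smooth g"
  shows "dl \<mu> (\<lambda>x. c * f x + d * g x) = (\<lambda>x. c * dl \<mu> f x + d * dl \<mu> g x)"
  using smooth_lincomb(2)[OF assms, of 1] by (simp add: dl_def algebra_simps)

lemma Lop_lincomb:
  assumes "smooth f" "smooth g"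
  shows "Lop \<mu>s (\<lambda>x. c * f x + d * g x) = (\<lambda>x. c * Lop \<mu>s f x + d * Lop \<mu>s g x)"
  by (induction \<mu>s) (auto simp: Lop_Cons dl_lincomb smooth_Lop assms simp del: Lop.simps(2))

lemma Espace_lincomb:
  assumes "f \<in> Espace \<mu>s" "g \<in> Espace \<mu>s"
  shows "(\<lambda>x. c * f x + d * g x) \<in> Espace \<mu>s"
  using assms by (auto simp: Espace_def Lop_lincomb smooth_lincomb)

lemma Espace_zero: "(\<lambda>_. 0) \<in> Espace \<mu>s"
proof -
  have "Lop \<mu>s (\<lambda>_. 0) = (\<lambda>_. 0)"
    using Lop_lincomb[OF smooth_zero smooth_zero, of \<mu>s 0 0] by simp
  then show ?thesis by (simp add: Espace_def smooth_zero)
qed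

lemma Espace_scale: "f \<in> Espace \<mu>s \<Longrightarrow> (\<lambda>x. c * f x) \<in> Espace \<mu>s"
  using Espace_lincomb[of f \<mu>s f c 0] by simp

lemma Espace_diff: "f \<in> Espace \<mu>s \<Longrightarrow> g \<in> Espace \<mu>s \<Longrightarrow> (\<lambda>x. f x - g x) \<in> Espace \<mu>s"
  using Espace_lincomb[of f \<mu>s g 1 "-1"] by simp

lemma Espace_sum:
  fixes m :: nat
  assumes "\<And>i. i < m \<Longrightarrow> p i \<in> Espace \<mu>s"
  shows "(\<lambda>x. \<Sum>i<m. c i * p i x) \<in> Espace \<mu>s"
  using assms
proof (induction m)
  case 0
  then show ?case by (simp add: Espace_zero)
next
  case (Suc m)
  then show ?case using Espace_lincomb[of "\<lambda>x. \<Sum>i<m. c i * p i x" \<mu>s "p m" 1 "c m"] by simp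
qed

lemma Espace_mono_Cons: "f \<in> Espace \<mu>s \<Longrightarrow> f \<in> Espace (\<mu> # \<mu>s)"
  using Dn_zero[of 1] by (simp add: Espace_def)

lemma dl_cnj:
  assumes "smooth f"
  shows "dl (cnj \<mu>) (\<lambda>x. cnj (f x)) = (\<lambda>x. cnj (dl \<mu> f x))"
  using smooth_cnj(2)[OF assms, of 1] by (simp add: dl_def)

lemma Espace_cnj:
  assumes "f \<in> Espace \<mu>s"
  shows "(\<lambda>x. cnj (f x)) \<in> Espace (map cnj \<mu>s)"
proof -
  have sm: "smooth f" using assms Espace_smooth by blast
  have "Lop (map cnj \<mu>s) (\<lambda>x. cnj (f x)) = (\<lambda>x. cnj (Lop \<mu>s f x))"
    by (induction \<mu>s) (auto simp: Lop_Cons dl_cnj smooth_Lop sm simp del: Lop.simps(2))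
  then show ?thesis using assms by (simp add: Espace_def smooth_cnj)
qed

section \<open>Solving first-order equations\<close>

text \<open>The integrating factor exp (- \<mu> x) turns the equation into a vanishing derivative,
  so the product is constant, and its value at \<open>x0\<close> is 0.\<close>

lemma dl_eq_zero_imp_zero:
  assumes "smooth g" "dl \<mu> g = (\<lambda>_. 0)" "g x0 = 0"
  shows "g = (\<lambda>_. 0)"
proof -
  define h where "h = (\<lambda>x. exp (- \<mu> * complex_of_real x) * g x)"
  have "(h has_vector_derivative 0) (at x)" for x
  proof -
    have "Dx g x = \<mu> * g x" using fun_cong[OF assms(2), of x] by (simp add: dl_def)
    then have "(g has_vector_derivative \<mu> * g x) (at x)"
      using smooth_has_vector_derivative[OF assms(1), of 0 x] by simp
    from has_vector_derivative_mult[OF has_vector_derivative_exp_mult[of "-\<mu>"] this]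
    show ?thesis unfolding h_def by (simp add: algebra_simps)
  qed
  then obtain c where c: "\<And>x. h x = c"
    using has_vector_derivative_zero_constant[of UNIV h] by auto
  have "c = 0" using c[of x0] assms(3) by (simp add: h_def)
  then show ?thesis using c by (auto simp: h_def)
qed

text \<open>Variation of constants: \<open>g\<close> is exp (\<mu> x) times the integral from a to x
  of exp (- \<mu> t) f t. This inverts a factor of the operator and lifts elements into larger
  spaces.\<close>

lemma solve_dl:
  fixes a :: real
  assumes "smooth f"
  obtains g where "smooth g" "g a = 0" "dl \<mu> g = f"
proof -
  define h where "h = (\<lambda>t. exp (- \<mu> * complex_of_real t) * f t)"
  define H where "H = (\<lambda>x::real. LBINT t=a..x. h t)"
  have cont_f: "continuous_on A f" for A
    using smooth_has_vector_derivative[OF assms, of 0]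
    by (auto intro!: continuous_at_imp_continuous_on dest: has_vector_derivative_continuous)
  have cont: "continuous_on A h" for A
    unfolding h_def by (intro continuous_intros cont_f)
  have H: "(H has_vector_derivative h x) (at x)" for x
  proof -
    \<comment> \<open>The fundamental theorem yields a derivative within a compact interval; the
      margin 1 makes x interior to it, so the derivative is two-sided.\<close>
    define l u where "l = min a x - 1" and "u = max a x + 1"
    have "((\<lambda>u. LBINT y=a..u. h y) has_vector_derivative h x) (at x within {l..u})"
      by (rule interval_integral_FTC2) (auto simp: l_def u_def cont)
    moreover have "at x within {l..u} = at x"
      by (rule at_within_interior) (auto simp: l_def u_def)
    ultimately show ?thesis by (simp add: H_def)
  qed
  define g where "g = (\<lambda>x. exp (\<mu> * complex_of_real x) * H x)"
  have g: "(g has_vector_derivative \<mu> * g x + f x) (at x)" for x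
  proof -
    have "exp (\<mu> * complex_of_real x) * h x = f x"
      by (simp add: h_def mult.assoc[symmetric] exp_add[symmetric])
    then show ?thesis
      using has_vector_derivative_mult[OF has_vector_derivative_exp_mult[of \<mu>] H[of x]]
      unfolding g_def by (simp add: algebra_simps)
  qed
  \<comment> \<open>The derivatives of \<open>g\<close>, read off from g' = \<mu> g + f by repeated
    differentiation.\<close>
  define F where "F = rec_nat g (\<lambda>k h x. \<mu> * h x + Dn k f x)"
  have F: "(F k has_vector_derivative F (Suc k) x) (at x)" for k x
  proof (induction k)
    case 0
    then show ?case using g by (simp add: F_def)
  next
    case (Suc k)
    have "F (Suc k) = (\<lambda>x. \<mu> * F k x + Dn k f x)" for k by (simp add: F_def)
    then show ?case
      using has_vector_derivative_add[OF has_vector_derivative_mult_right[OF Suc, of \<mu>]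
          smooth_has_vector_derivative[OF assms, of k x]] by simp
  qed
  have "smooth g" using smoothI[of F, OF F] by (simp add: F_def)
  moreover have "g a = 0" by (simp add: g_def H_def)
  moreover have "dl \<mu> g = f"
    using has_vector_derivative_imp_Dx[of g, OF g] by (simp add: dl_def)
  ultimately show ?thesis by (rule that)
qed

section \<open>Orders of vanishing and uniqueness at one point\<close>

text \<open>Zero of order at least k. Unlike the exact order in \<open>zero_order\<close>, this
  condition passes to linear combinations.\<close>

definition vanish :: "(real \<Rightarrow> complex) \<Rightarrow> real \<Rightarrow> nat \<Rightarrow> bool" where
  "vanish f a k \<longleftrightarrow> (\<forall>j<k. Dn j f a = 0)"

lemma vanish_mono: "vanish f a k \<Longrightarrow> j \<le> k \<Longrightarrow> vanish f a j"
  by (auto simp: vanish_def)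

lemma vanish_Suc: "vanish f a (Suc k) \<longleftrightarrow> vanish f a k \<and> Dn k f a = 0"
  by (auto simp: vanish_def less_Suc_eq)

lemma vanish_dl: "smooth f \<Longrightarrow> vanish f a k \<Longrightarrow> vanish (dl \<mu> f) a (k - 1)"
  by (auto simp: vanish_def smooth_dl simp del: Dn.simps(2))

lemma vanish_lincomb:
  "smooth f \<Longrightarrow> smooth g \<Longrightarrow> vanish f a k \<Longrightarrow> vanish g a k \<Longrightarrow> vanish (\<lambda>x. c * f x + d * g x) a k"
  by (auto simp: vanish_def smooth_lincomb)

lemma vanish_diff:
  "smooth f \<Longrightarrow> smooth g \<Longrightarrow> vanish f a k \<Longrightarrow> vanish g a k \<Longrightarrow> vanish (\<lambda>x. f x - g x) a k"
  by (auto simp: vanish_def smooth_diff)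

lemma vanish_zero: "vanish (\<lambda>_. 0) a k"
  by (simp add: vanish_def Dn_zero)

text \<open>Each factor costs at most one order of vanishing. The induction runs from the right end
  because the last factor in the list acts first.\<close>

lemma Lop_vanish:
  assumes "smooth f" "vanish f x0 (Suc (length \<mu>s))"
  shows "Lop \<mu>s f x0 = 0"
  using assms
proof (induction \<mu>s arbitrary: f rule: rev_induct)
  case Nil
  then show ?case by (simp add: vanish_def)
next
  case (snoc \<mu> \<mu>s)
  have "Lop \<mu>s (dl \<mu> f) x0 = 0"
    using snoc.IH[of "dl \<mu> f"] vanish_dl[OF snoc.prems, of \<mu>] snoc.prems(1) by (simp add: smooth_dl)
  then show ?case by (simp add: Lop_append dl_def)
qed

text \<open>Uniqueness for the initial value problem: with all factors but the outermost applied,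
  the result solves a homogeneous first-order equation and still vanishes at \<open>x0\<close>, so f
  already lies in the space for the tail.\<close>

lemma Espace_vanish_imp_zero:
  assumes "f \<in> Espace \<mu>s" "vanish f x0 (length \<mu>s)"
  shows "f = (\<lambda>_. 0)"
  using assms
proof (induction \<mu>s)
  case Nil
  then show ?case using Espace_Nil by simp
next
  case (Cons \<mu> \<mu>s)
  have sm: "smooth f" using Cons.prems Espace_smooth by blast
  have "Lop \<mu>s f = (\<lambda>_. 0)"
  proof (rule dl_eq_zero_imp_zero)
    show "smooth (Lop \<mu>s f)" by (simp add: sm smooth_Lop)
    show "dl \<mu> (Lop \<mu>s f) = (\<lambda>_. 0)"
      using Cons.prems by (simp add: Espace_def Lop_Cons del: Lop.simps(2))
    show "Lop \<mu>s f x0 = 0" using Lop_vanish[OF sm] Cons.prems by simp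
  qed
  then have "f \<in> Espace \<mu>s" by (simp add: Espace_def sm)
  then show ?case using Cons.IH vanish_mono[OF Cons.prems(2)] by simp
qed

section \<open>Exponentials and conjugation of the exponents\<close>

lemma Lop_exp:
  "Lop \<mu>s (\<lambda>x. exp (\<mu> * complex_of_real x))
    = (\<lambda>x. (\<Prod>\<nu>\<leftarrow>\<mu>s. \<mu> - \<nu>) * exp (\<mu> * complex_of_real x))"
proof (induction \<mu>s)
  case Nil
  then show ?case by simp
next
  case (Cons \<nu> \<mu>s)
  have D: "Dx (\<lambda>x. c * exp (\<mu> * complex_of_real x)) = (\<lambda>x. c * (\<mu> * exp (\<mu> * complex_of_real x)))" for c
    by (intro has_vector_derivative_imp_Dx has_vector_derivative_mult_right
        has_vector_derivative_exp_mult)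
  show ?case unfolding Lop.simps Cons D by (simp add: algebra_simps)
qed

text \<open>The factor \<open>c\<close> is the characteristic polynomial evaluated at \<mu>; its
  roots are the exponents, so the space determines their set.\<close>

lemma exp_in_Espace_iff: "(\<lambda>x. exp (\<mu> * complex_of_real x)) \<in> Espace \<mu>s \<longleftrightarrow> \<mu> \<in> set \<mu>s"
proof -
  define c where "c = (\<Prod>\<nu>\<leftarrow>\<mu>s. \<mu> - \<nu>)"
  have "(\<lambda>x. exp (\<mu> * complex_of_real x)) \<in> Espace \<mu>s \<longleftrightarrow> (\<forall>x. c * exp (\<mu> * complex_of_real x) = 0)"
    unfolding Espace_def mem_Collect_eq Lop_exp c_def[symmetric] fun_eq_iff
    using smooth_exp by blast
  also have "\<dots> \<longleftrightarrow> c = 0" by simp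
  also have "\<dots> \<longleftrightarrow> \<mu> \<in> set \<mu>s" unfolding c_def prod_list_zero_iff by auto
  finally show ?thesis .
qed

lemma closed_cnj_mset_cong: "mset xs = mset ys \<Longrightarrow> closed_cnj xs \<longleftrightarrow> closed_cnj ys"
  unfolding closed_cnj_def by (simp add: Espace_mset_cong[of xs ys])

text \<open>Lift f through D - \<mu>, conjugate in the larger space, and come back; for real \<mu>
  the factor commutes with conjugation.\<close>

lemma closed_cnj_real_tail:
  assumes "closed_cnj (\<mu> # \<mu>s)" "cnj \<mu> = \<mu>"
  shows "closed_cnj \<mu>s"
  unfolding closed_cnj_def
proof
  fix f assume f: "f \<in> Espace \<mu>s"
  obtain g where g: "smooth g" "dl \<mu> g = f" using solve_dl Espace_smooth f by metis
  have "g \<in> Espace (\<mu> # \<mu>s)" using Espace_Cons_iff g f by blast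
  then have "(\<lambda>x. cnj (g x)) \<in> Espace (\<mu> # \<mu>s)" using assms by (auto simp: closed_cnj_def)
  from Espace_dl[OF this] show "(\<lambda>x. cnj (f x)) \<in> Espace \<mu>s"
    using dl_cnj[OF g(1), of \<mu>] assms(2) g(2) by simp
qed

text \<open>Here f is lifted through both factors. Conjugation exchanges them, so their order is
  switched before descending.\<close>

lemma closed_cnj_pair_tail:
  assumes "closed_cnj (\<mu> # cnj \<mu> # \<mu>s)"
  shows "closed_cnj \<mu>s"
  unfolding closed_cnj_def
proof
  fix f assume f: "f \<in> Espace \<mu>s"
  obtain h where h: "smooth h" "dl (cnj \<mu>) h = f" using solve_dl Espace_smooth f by metis
  obtain g where g: "smooth g" "dl \<mu> g = h" using solve_dl h by metis
  have "h \<in> Espace (cnj \<mu> # \<mu>s)" using Espace_Cons_iff h f by blast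
  then have "g \<in> Espace (\<mu> # cnj \<mu> # \<mu>s)" using Espace_Cons_iff g by blast
  then have "(\<lambda>x. cnj (g x)) \<in> Espace (\<mu> # cnj \<mu> # \<mu>s)" using assms by (auto simp: closed_cnj_def)
  also have "Espace (\<mu> # cnj \<mu> # \<mu>s) = Espace (cnj \<mu> # \<mu> # \<mu>s)"
    by (rule Espace_mset_cong) simp
  finally have "dl (cnj \<mu>) (\<lambda>x. cnj (g x)) \<in> Espace (\<mu> # \<mu>s)" by (rule Espace_dl)
  then have "(\<lambda>x. cnj (h x)) \<in> Espace (\<mu> # \<mu>s)" using dl_cnj[OF g(1), of \<mu>] g(2) by simp
  from Espace_dl[OF this] show "(\<lambda>x. cnj (f x)) \<in> Espace \<mu>s"
    using dl_cnj[OF h(1), of "cnj \<mu>"] h(2) by simp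
qed

text \<open>Translates the hypothesis on functions into one on exponents with multiplicity.
  Exponentials show only that \<open>cnj \<mu>\<close> occurs; multiplicities follow by removing a
  real exponent or a conjugate pair, whence strong induction on the length.\<close>

lemma closed_cnj_imp_mset:
  assumes "closed_cnj \<mu>s"
  shows "image_mset cnj (mset \<mu>s) = mset \<mu>s"
  using assms
proof (induction "length \<mu>s" arbitrary: \<mu>s rule: less_induct)
  case less
  show ?case
  proof (cases \<mu>s)
    case Nil
    then show ?thesis by simp
  next
    case (Cons \<mu> \<nu>s)
    show ?thesis
    proof (cases "cnj \<mu> = \<mu>")
      case True
      then have "closed_cnj \<nu>s" using closed_cnj_real_tail less.prems Cons by blast
      then show ?thesis using less.hyps[of \<nu>s] True Cons by simp
    next
      case False
      have "(\<lambda>x. cnj (exp (\<mu> * complex_of_real x))) \<in> Espace \<mu>s"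
        using less.prems exp_in_Espace_iff[of \<mu> \<mu>s] Cons by (auto simp: closed_cnj_def)
      then have "(\<lambda>x. exp (cnj \<mu> * complex_of_real x)) \<in> Espace \<mu>s"
        by (simp add: exp_cnj)
      then have "cnj \<mu> \<in> set \<nu>s" using exp_in_Espace_iff Cons False by auto
      then have eq: "mset \<mu>s = mset (\<mu> # cnj \<mu> # remove1 (cnj \<mu>) \<nu>s)" using Cons by simp
      then have "closed_cnj (remove1 (cnj \<mu>) \<nu>s)"
        using closed_cnj_mset_cong[OF eq] less.prems closed_cnj_pair_tail by blast
      moreover have "length (remove1 (cnj \<mu>) \<nu>s) < length \<mu>s"
        using Cons by (simp add: length_remove1 less_Suc_eq_le)
      ultimately have "image_mset cnj (mset (remove1 (cnj \<mu>) \<nu>s)) = mset (remove1 (cnj \<mu>) \<nu>s)"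
        using less.hyps by blast
      then show ?thesis unfolding eq by (simp add: add_mset_commute)
    qed
  qed
qed

section \<open>The extended Chebyshev property\<close>

text \<open>Rolle between neighbouring points. The clause placing each point of \<open>T\<close>
  below some point of \<open>S\<close> keeps the induction going: the next zero lies to the right of
  the old maximum and is therefore new.\<close>

lemma Rolle_finite:
  fixes u u' :: "real \<Rightarrow> real"
  assumes "finite S" "S \<subseteq> {a..b}" "\<And>x. x \<in> S \<Longrightarrow> u x = 0"
    and "\<And>x. x \<in> {a..b} \<Longrightarrow> (u has_real_derivative u' x) (at x)"
  shows "\<exists>T. finite T \<and> T \<subseteq> {a<..<b} \<and> (\<forall>x\<in>T. u' x = 0 \<and> (\<exists>y\<in>S. x < y)) \<and> card S \<le> card T + 1"
  using assms(1-3)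
proof (induction rule: finite_linorder_max_induct)
  case empty
  then show ?case by (intro exI[of _ "{}"]) auto
next
  case (insert m S)
  show ?case
  proof (cases "S = {}")
    case True
    then show ?thesis by (intro exI[of _ "{}"]) auto
  next
    case False
    obtain T where T: "finite T" "T \<subseteq> {a<..<b}" "\<forall>x\<in>T. u' x = 0 \<and> (\<exists>y\<in>S. x < y)"
        "card S \<le> card T + 1"
      using insert by auto
    define l where "l = Max S"
    have l: "l \<in> S" "\<And>x. x \<in> S \<Longrightarrow> x \<le> l" using False insert.hyps by (auto simp: l_def)
    have lm: "l < m" "a \<le> l" "m \<le> b" using l insert by auto
    have "\<exists>z. l < z \<and> z < m \<and> (u has_real_derivative 0) (at z)"
    proof (rule Rolle)
      show "l < m" by fact
      show "u l = u m" using l insert.prems by auto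
      show "continuous_on {l..m} u"
        using lm by (intro continuous_at_imp_continuous_on ballI DERIV_isCont[OF assms(4)]) auto
      show "u differentiable at x" if "l < x" "x < m" for x
        using assms(4)[of x] that lm by (auto simp: real_differentiable_def)
    qed
    then obtain z where z: "l < z" "z < m" "(u has_real_derivative 0) (at z)" by blast
    then have u'z: "u' z = 0" using assms(4)[of z] lm DERIV_unique by auto
    have "z \<notin> T" using T(3) l z by force
    moreover have "m \<notin> S" using insert.hyps by auto
    ultimately show ?thesis
      using T z u'z lm insert.hyps by (intro exI[of _ "insert z T"]) auto
  qed
qed

text \<open>With w = cos (\<beta> (x - c)), Rolle is applied to u = y / w and then to v = w y' - w'
  y, whose quotient by w^2 is u'. At points of \<open>D\<close> both y and y' vanish, so
  \<open>D\<close> supplies further zeros of v for the second application.\<close>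

lemma Rolle_oscillator:
  fixes y y1 y2 :: "real \<Rightarrow> real"
  assumes y: "\<And>x. (y has_real_derivative y1 x) (at x)"
    and y1: "\<And>x. (y1 has_real_derivative y2 x) (at x)"
    and ab: "a < b" "\<bar>\<beta>\<bar> * (b - a) < pi"
    and S: "finite S" "S \<subseteq> {a..b}" "\<And>x. x \<in> S \<Longrightarrow> y x = 0"
    and D: "D \<subseteq> {a, b}" "\<And>x. x \<in> D \<Longrightarrow> y x = 0 \<and> y1 x = 0"
  shows "\<exists>T. finite T \<and> T \<subseteq> {a<..<b} \<and> (\<forall>x\<in>T. y2 x + \<beta>\<^sup>2 * y x = 0) \<and> card S + card D \<le> card T + 2"
proof -
  define c where "c = (a + b) / 2"
  have cos_pos: "cos (\<beta> * (x - c)) > 0" if "x \<in> {a..b}" for x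
  proof -
    have "a \<le> x" "x \<le> b" using that by auto
    then have "x - c \<le> (b - a) / 2" "- (x - c) \<le> (b - a) / 2"
      unfolding c_def by (simp_all add: field_simps)
    then have "\<bar>x - c\<bar> \<le> (b - a) / 2" by (rule abs_leI)
    then have "\<bar>\<beta> * (x - c)\<bar> \<le> \<bar>\<beta>\<bar> * ((b - a) / 2)"
      unfolding abs_mult by (intro mult_left_mono) auto
    then have "\<bar>\<beta> * (x - c)\<bar> < pi / 2" using ab by simp
    then show ?thesis by (intro cos_gt_zero_pi) auto
  qed
  define u v where "u = (\<lambda>x. y x / cos (\<beta> * (x - c)))"
    and "v = (\<lambda>x. y1 x * cos (\<beta> * (x - c)) + \<beta> * y x * sin (\<beta> * (x - c)))"
  have u: "(u has_real_derivative v x / (cos (\<beta> * (x - c)))\<^sup>2) (at x)" if "x \<in> {a..b}" for x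
    unfolding u_def v_def using cos_pos[OF that]
    by (auto intro!: derivative_eq_intros y simp: power2_eq_square algebra_simps)
  have v: "(v has_real_derivative cos (\<beta> * (x - c)) * (y2 x + \<beta>\<^sup>2 * y x)) (at x)" for x
    unfolding v_def
    by (auto intro!: derivative_eq_intros y y1 simp: power2_eq_square algebra_simps)
  obtain T1 where T1: "finite T1" "T1 \<subseteq> {a<..<b}"
      "\<And>x. x \<in> T1 \<Longrightarrow> v x / (cos (\<beta> * (x - c)))\<^sup>2 = 0" "card S \<le> card T1 + 1"
    using Rolle_finite[OF S(1,2) _ u] S(3) unfolding u_def by (metis div_0)
  have T1v: "v x = 0" if "x \<in> T1" for x
  proof -
    have "cos (\<beta> * (x - c)) > 0" using cos_pos[of x] that T1(2) by auto
    then show ?thesis using T1(3)[OF that] by simp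
  qed
  have finD: "finite D" using D(1) finite_subset by blast
  have "\<exists>T. finite T \<and> T \<subseteq> {a<..<b} \<and> (\<forall>x\<in>T. cos (\<beta> * (x - c)) * (y2 x + \<beta>\<^sup>2 * y x) = 0 \<and> (\<exists>y\<in>T1 \<union> D. x < y))
      \<and> card (T1 \<union> D) \<le> card T + 1"
  proof (rule Rolle_finite)
    show "finite (T1 \<union> D)" using T1 finD by simp
    show "T1 \<union> D \<subseteq> {a..b}" using T1(2) D(1) ab by auto
    show "v x = 0" if "x \<in> T1 \<union> D" for x using that T1v D(2) by (auto simp: v_def)
  qed (rule v)
  then obtain T where T: "finite T" "T \<subseteq> {a<..<b}"
      "\<And>x. x \<in> T \<Longrightarrow> cos (\<beta> * (x - c)) * (y2 x + \<beta>\<^sup>2 * y x) = 0" "card (T1 \<union> D) \<le> card T + 1"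
    by blast
  \<comment> \<open>The zeros from the first application are interior and those in \<open>D\<close>
    are endpoints, so nothing is counted twice.\<close>
  have "card (T1 \<union> D) = card T1 + card D"
    using T1(2) D(1) by (intro card_Un_disjoint T1(1) finD) fastforce
  moreover have "y2 x + \<beta>\<^sup>2 * y x = 0" if "x \<in> T" for x
  proof -
    have "cos (\<beta> * (x - c)) > 0" using cos_pos[of x] that T(2) by auto
    then show ?thesis using T(3)[OF that] by simp
  qed
  ultimately show ?thesis using T T1(4) by (intro exI[of _ T]) auto
qed

lemma Re_has_derivative:
  assumes "smooth f"
  shows "((\<lambda>x. Re (Dn k f x)) has_real_derivative Re (Dn (Suc k) f x)) (at x)"
  using bounded_linear.has_vector_derivative[OF bounded_linear_Re smooth_has_vector_derivative[OF assms]]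
  by (simp add: has_real_derivative_iff_has_vector_derivative)

section \<open>Loss of zeros under a real factor and under a conjugate pair\<close>

text \<open>Endpoints at which the prescribed order, i at a and j at b, is at least r: r = 1
  collects zeros, r = 2 double zeros.\<close>

definition endpts :: "real \<Rightarrow> real \<Rightarrow> nat \<Rightarrow> nat \<Rightarrow> nat \<Rightarrow> real set" where
  "endpts a b i j r = (if r \<le> i then {a} else {}) \<union> (if r \<le> j then {b} else {})"

text \<open>Rolle for exp (- Re \<mu> x) Re f counts each endpoint zero once; the remaining
  multiplicities i - 1 and j - 1 pass to \<open>dl \<mu> f\<close>. Truncated subtraction covers
  order 0.\<close>

lemma zeros_dl:
  assumes f: "smooth f" "\<And>x. Im (f x) = 0" and \<mu>: "Im \<mu> = 0" and "a < b"
    and van: "vanish f a i" "vanish f b j"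
    and S: "finite S" "S \<subseteq> {a<..<b}" "\<And>x. x \<in> S \<Longrightarrow> f x = 0"
  shows "\<exists>T. finite T \<and> T \<subseteq> {a<..<b} \<and> (\<forall>x\<in>T. Re (dl \<mu> f x) = 0)
    \<and> card S + i + j \<le> card T + (i - 1) + (j - 1) + 1"
proof -
  define r where "r = (\<lambda>x. Re (f x))"
  define u where "u = (\<lambda>x. exp (- Re \<mu> * x) * r x)"
  have r: "(r has_real_derivative Re (Dx f x)) (at x)" for x
    using Re_has_derivative[OF f(1), of 0 x] by (simp add: r_def)
  have "(u has_real_derivative exp (- Re \<mu> * x) * (Re (Dx f x) - Re \<mu> * r x)) (at x)" for x
    unfolding u_def by (rule derivative_eq_intros r refl)+ (simp add: algebra_simps)
  then have u: "(u has_real_derivative exp (- Re \<mu> * x) * Re (dl \<mu> f x)) (at x)" for x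
    by (simp add: dl_def \<mu> r_def)
  define E where "E = endpts a b i j 1"
  have E: "E \<subseteq> {a, b}" "card E = min i 1 + min j 1"
    using \<open>a < b\<close> by (auto simp: E_def endpts_def min_def)
  have "f x = 0" if "x \<in> E" for x
    using that van by (auto simp: E_def endpts_def vanish_def split: if_splits)
  then have zero: "u x = 0" if "x \<in> S \<union> E" for x using that S(3) by (auto simp: u_def r_def)
  have fin: "finite (S \<union> E)" using S(1) finite_subset[OF E(1)] by simp
  have "S \<union> E \<subseteq> {a..b}" using S(2) E(1) \<open>a < b\<close> by auto
  from Rolle_finite[OF fin this zero u] obtain T where T: "finite T" "T \<subseteq> {a<..<b}"
      "\<forall>x\<in>T. exp (- Re \<mu> * x) * Re (dl \<mu> f x) = 0" "card (S \<union> E) \<le> card T + 1"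
    by blast
  have "card (S \<union> E) = card S + card E"
    using S(2) E(1) by (intro card_Un_disjoint S(1) finite_subset[OF E(1)]) (simp, fastforce)
  then have "card S + i + j \<le> card T + (i - 1) + (j - 1) + 1" using E(2) T(4) by linarith
  moreover have "\<forall>x\<in>T. Re (dl \<mu> f x) = 0" using T(3) by simp
  ultimately show ?thesis using T(1,2) by blast
qed

text \<open>The product of conjugate factors has real coefficients, so it is compatible with taking
  real parts.\<close>

lemma dl_dl_cnj:
  assumes "smooth f"
  shows "dl \<mu> (dl (cnj \<mu>) f) x = Dn 2 f x - complex_of_real (2 * Re \<mu>) * Dn 1 f x
    + complex_of_real ((Re \<mu>)\<^sup>2 + (Im \<mu>)\<^sup>2) * f x"
proof -
  have "dl \<mu> (dl (cnj \<mu>) f) x = Dn 2 f x - (\<mu> + cnj \<mu>) * Dn 1 f x + \<mu> * cnj \<mu> * f x"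
    using smooth_dl(2)[OF assms, of 1 "cnj \<mu>"] unfolding dl_def[of \<mu>]
    by (simp add: dl_def algebra_simps numeral_2_eq_2)
  then show ?thesis by (simp add: complex_add_cnj complex_mult_cnj)
qed

lemma zeros_dl_pair:
  assumes f: "smooth f" "\<And>x. Im (f x) = 0" and "a < b" "\<bar>Im \<mu>\<bar> * (b - a) < pi"
    and van: "vanish f a i" "vanish f b j"
    and S: "finite S" "S \<subseteq> {a<..<b}" "\<And>x. x \<in> S \<Longrightarrow> f x = 0"
  shows "\<exists>T. finite T \<and> T \<subseteq> {a<..<b} \<and> (\<forall>x\<in>T. Re (dl \<mu> (dl (cnj \<mu>) f) x) = 0)
    \<and> card S + i + j \<le> card T + (i - 2) + (j - 2) + 2"
proof -
  define e where "e = (\<lambda>x. exp (- Re \<mu> * x))"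
  define r r1 r2 where "r = (\<lambda>x. Re (f x))" and "r1 = (\<lambda>x. Re (Dn 1 f x))"
    and "r2 = (\<lambda>x. Re (Dn 2 f x))"
  \<comment> \<open>Multiplying by exp (- Re \<mu> x) removes the first-order term: y'' + (Im
    \<mu>)^2 y is that factor times the real part of the image of f under both factors.\<close>
  define y y1 y2 where "y = (\<lambda>x. e x * r x)"
    and "y1 = (\<lambda>x. e x * (r1 x - Re \<mu> * r x))"
    and "y2 = (\<lambda>x. e x * (r2 x - 2 * Re \<mu> * r1 x + (Re \<mu>)\<^sup>2 * r x))"
  have f1: "(r has_real_derivative r1 x) (at x)" for x
    using Re_has_derivative[OF f(1), of 0 x] by (simp add: r_def r1_def)
  have f2: "(r1 has_real_derivative r2 x) (at x)" for x
    using Re_has_derivative[OF f(1), of 1 x] by (simp add: r1_def r2_def numeral_2_eq_2)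
  have e: "(e has_real_derivative - Re \<mu> * e x) (at x)" for x
    unfolding e_def by (auto intro!: derivative_eq_intros)
  have y: "(y has_real_derivative y1 x) (at x)" for x
    unfolding y_def y1_def by (auto intro!: derivative_eq_intros e f1 simp: algebra_simps)
  have y1: "(y1 has_real_derivative y2 x) (at x)" for x
    unfolding y1_def y2_def
    by (auto intro!: derivative_eq_intros e f1 f2 simp: algebra_simps power2_eq_square)
  have y2: "y2 x + (Im \<mu>)\<^sup>2 * y x = e x * Re (dl \<mu> (dl (cnj \<mu>) f) x)" for x
    unfolding dl_dl_cnj[OF f(1)] y2_def y_def r_def r1_def r2_def by (simp add: algebra_simps)
  define E D where "E = endpts a b i j 1" and "D = endpts a b i j 2"
  \<comment> \<open>An order i at an endpoint is used up as min i 1 in \<open>E\<close>, min i 2 - 1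
    in \<open>D\<close>, and i - 2 carried over; with truncated subtraction these add up to i in
    every case.\<close>
  have E: "E \<subseteq> {a, b}" "card E = min i 1 + min j 1" "D \<subseteq> {a, b}" "card D = min i 2 - 1 + (min j 2 - 1)"
    using \<open>a < b\<close> by (auto simp: E_def D_def endpts_def min_def)
  have fE: "f x = 0" if "x \<in> E" for x
    using that van by (auto simp: E_def endpts_def vanish_def split: if_splits)
  have fD: "f x = 0 \<and> Dn 1 f x = 0" if "x \<in> D" for x
  proof -
    have "vanish f x 2"
      using that vanish_mono[OF van(1)] vanish_mono[OF van(2)]
      by (auto simp: D_def endpts_def split: if_splits)
    then show ?thesis by (auto simp: vanish_Suc numeral_2_eq_2)
  qed
  have "\<exists>T. finite T \<and> T \<subseteq> {a<..<b} \<and> (\<forall>x\<in>T. y2 x + (Im \<mu>)\<^sup>2 * y x = 0)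
      \<and> card (S \<union> E) + card D \<le> card T + 2"
  proof (rule Rolle_oscillator[OF y y1 assms(3,4)])
    show "finite (S \<union> E)" using S(1) finite_subset[OF E(1)] by simp
    show "S \<union> E \<subseteq> {a..b}" using S(2) E(1) \<open>a < b\<close> by auto
    show "y x = 0" if "x \<in> S \<union> E" for x using that S(3) fE by (auto simp: y_def r_def)
    show "y x = 0 \<and> y1 x = 0" if "x \<in> D" for x
      using fD[OF that] by (simp add: y_def y1_def r_def r1_def)
  qed (rule E(3))
  then obtain T where T: "finite T" "T \<subseteq> {a<..<b}" "\<forall>x\<in>T. y2 x + (Im \<mu>)\<^sup>2 * y x = 0"
      "card (S \<union> E) + card D \<le> card T + 2" by blast
  have "card (S \<union> E) = card S + card E"
    using S(2) E(1) by (intro card_Un_disjoint S(1) finite_subset[OF E(1)]) (simp, fastforce)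
  then have "card S + i + j \<le> card T + (i - 2) + (j - 2) + 2" using E(2,4) T(4) by linarith
  moreover have "\<forall>x\<in>T. Re (dl \<mu> (dl (cnj \<mu>) f) x) = 0" using T(3) unfolding y2 by (simp add: e_def)
  ultimately show ?thesis using T(1,2) by blast
qed

text \<open>Standing hypothesis, sufficient for the Chebyshev property on [a,b]. Conjugation
  invariance is required with multiplicity, and the length bound is multiplied out so that real
  exponents impose no restriction.\<close>

definition disconj :: "real \<Rightarrow> real \<Rightarrow> complex list \<Rightarrow> bool" where
  "disconj a b \<mu>s \<longleftrightarrow> a < b \<and> image_mset cnj (mset \<mu>s) = mset \<mu>s \<and> (\<forall>\<mu>\<in>set \<mu>s. \<bar>Im \<mu>\<bar> * (b - a) < pi)"

lemma disconj_real_tail: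
  assumes "disconj a b (\<mu> # \<mu>s)" "Im \<mu> = 0"
  shows "disconj a b \<mu>s"
proof -
  have "cnj \<mu> = \<mu>" using assms(2) by (simp add: complex_eq_iff)
  then show ?thesis using assms(1) by (auto simp: disconj_def)
qed

text \<open>Terminal case of the zero count. Up to a constant, f is exp (\<mu> (x - x0)) - exp (cnj
  \<mu> (x - x0)), that is, 2 \<i> exp (Re \<mu> (x - x0)) sin (Im \<mu> (x - x0)), and the bound on
  Im \<mu> excludes another zero of the sine in [a,b].\<close>

lemma Espace_pair_two_zeros:
  assumes f: "f \<in> Espace [\<mu>, cnj \<mu>]" and \<mu>: "Im \<mu> \<noteq> 0" "\<bar>Im \<mu>\<bar> * (b - a) < pi"
    and x: "x0 \<in> {a..b}" "x1 \<in> {a..b}" "x0 \<noteq> x1" "f x0 = 0" "f x1 = 0"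
  shows "f = (\<lambda>_. 0)"
proof -
  define e where "e = (\<lambda>\<nu> x. exp (\<nu> * complex_of_real x))"
  define h where "h = (\<lambda>x. e \<mu> (-x0) * e \<mu> x + (- e (cnj \<mu>) (-x0)) * e (cnj \<mu>) x)"
  have e: "e \<nu> \<in> Espace [\<mu>, cnj \<mu>]" if "\<nu> \<in> {\<mu>, cnj \<mu>}" for \<nu>
    using exp_in_Espace_iff[of \<nu> "[\<mu>, cnj \<mu>]"] that by (simp add: e_def)
  have hE: "h \<in> Espace [\<mu>, cnj \<mu>]"
    unfolding h_def by (rule Espace_lincomb) (use e in auto)
  have sme: "smooth (e \<nu>)" for \<nu> unfolding e_def by (rule smooth_exp)
  have De: "Dx (e \<nu>) = (\<lambda>x. \<nu> * e \<nu> x)" for \<nu>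
    unfolding e_def by (intro has_vector_derivative_imp_Dx has_vector_derivative_exp_mult)
  have ee: "e \<nu> (-x0) * e \<nu> x0 = 1" for \<nu> by (simp add: e_def flip: exp_add)
  have "Dx h x0 = e \<mu> (-x0) * (\<mu> * e \<mu> x0) - e (cnj \<mu>) (-x0) * (cnj \<mu> * e (cnj \<mu>) x0)"
    using smooth_lincomb(2)[OF sme[of \<mu>] sme[of "cnj \<mu>"], of 1 "e \<mu> (-x0)" "- e (cnj \<mu>) (-x0)"]
    by (simp add: De h_def)
  also have "\<dots> = \<mu> - cnj \<mu>" using ee[of \<mu>] ee[of "cnj \<mu>"] by algebra
  finally have Dh: "Dx h x0 \<noteq> 0" using \<mu>(1) by (simp add: complex_eq_iff)
  \<comment> \<open>\<open>K\<close> matches the first derivatives at \<open>x0\<close>, so f - K h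
    has a double zero there and vanishes identically.\<close>
  define K where "K = Dx f x0 / Dx h x0"
  have "(\<lambda>x. 1 * f x + (-K) * h x) = (\<lambda>_. 0)"
  proof (rule Espace_vanish_imp_zero)
    show "(\<lambda>x. 1 * f x + (-K) * h x) \<in> Espace [\<mu>, cnj \<mu>]" by (rule Espace_lincomb[OF f hE])
    have "h x0 = 0" using ee by (simp add: h_def)
    then show "vanish (\<lambda>x. 1 * f x + (-K) * h x) x0 (length [\<mu>, cnj \<mu>])"
      unfolding vanish_def smooth_lincomb(2)[OF Espace_smooth[OF f] Espace_smooth[OF hE]]
      using Dh x(4) by (auto simp: K_def less_Suc_eq)
  qed
  then have fK: "f x = K * h x" for x by (simp add: fun_eq_iff)
  have "h x1 \<noteq> 0"
  proof
    assume "h x1 = 0"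
    then have "exp (\<mu> * (x1 - x0)) = exp (cnj \<mu> * (x1 - x0))"
      by (simp add: h_def e_def algebra_simps flip: exp_add)
    then have "sin (Im \<mu> * (x1 - x0)) = - sin (Im \<mu> * (x1 - x0))"
      by (auto simp: complex_eq_iff Im_exp)
    then have "sin (Im \<mu> * (x1 - x0)) = 0" by simp
    moreover have "\<bar>Im \<mu> * (x1 - x0)\<bar> < pi"
    proof -
      have "\<bar>Im \<mu> * (x1 - x0)\<bar> \<le> \<bar>Im \<mu>\<bar> * (b - a)"
        unfolding abs_mult using x by (intro mult_left_mono) auto
      then show ?thesis using \<mu>(2) by simp
    qed
    ultimately have "Im \<mu> * (x1 - x0) = 0" using sin_eq_0_pi[of "Im \<mu> * (x1 - x0)"] by linarith
    then show False using \<mu>(1) x(3) by simp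
  qed
  then have "K = 0" using fK[of x1] x(5) by simp
  then show ?thesis using fK by auto
qed

text \<open>Chebyshev property for real-valued f, with interior zeros counted once and endpoint
  zeros with multiplicity. A real exponent or a conjugate pair is stripped off; the image keeps
  enough zeros to vanish by induction, and then f lies in the kernel of the stripped factors, where
  its zeros leave only 0.\<close>

lemma real_zeros_imp_zero:
  assumes "disconj a b \<mu>s" "f \<in> Espace \<mu>s" "\<And>x. Im (f x) = 0"
    and "vanish f a i" "vanish f b j"
    and "finite S" "S \<subseteq> {a<..<b}" "\<And>x. x \<in> S \<Longrightarrow> f x = 0"
    and "length \<mu>s \<le> card S + i + j"
  shows "f = (\<lambda>_. 0)"
  using assms
proof (induction "length \<mu>s" arbitrary: \<mu>s f i j S rule: less_induct)
  case less
  note sm = Espace_smooth[OF less.prems(2)]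
  have ab: "a < b" using less.prems(1) by (simp add: disconj_def)
  show ?case
  proof (cases \<mu>s)
    case Nil
    then show ?thesis using Espace_Nil less.prems(2) by blast
  next
    case (Cons \<mu> \<nu>s)
    show ?thesis
    proof (cases "Im \<mu> = 0")
      case True
      define g where "g = dl \<mu> f"
      have g: "g \<in> Espace \<nu>s" unfolding g_def using less.prems(2) Cons Espace_dl by blast
      have "cnj (f x) = f x" for x using less.prems(3) by (simp add: complex_eq_iff)
      moreover have "cnj \<mu> = \<mu>" using True by (simp add: complex_eq_iff)
      ultimately have "cnj (g x) = g x" for x
        using dl_cnj[OF sm, of \<mu>] by (simp add: g_def fun_eq_iff)
      then have Img: "Im (g x) = 0" for x by (metis Reals_cnj_iff complex_is_Real_iff)
      obtain T where T: "finite T" "T \<subseteq> {a<..<b}" "\<And>x. x \<in> T \<Longrightarrow> Re (g x) = 0"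
          "card S + i + j \<le> card T + (i - 1) + (j - 1) + 1"
        using zeros_dl[OF sm less.prems(3) True ab less.prems(4-8)] by (auto simp: g_def)
      have g0: "g = (\<lambda>_. 0)"
      proof (rule less.hyps[OF _ _ g Img])
        show "disconj a b \<nu>s" using disconj_real_tail less.prems(1) Cons True by blast
        show "vanish g a (i - 1)" "vanish g b (j - 1)"
          using vanish_dl sm less.prems by (auto simp: g_def)
        show "g x = 0" if "x \<in> T" for x using T(3)[OF that] Img by (simp add: complex_eq_iff)
        show "length \<nu>s \<le> card T + (i - 1) + (j - 1)" using T(4) less.prems(9) Cons by simp
      qed (use Cons T in auto)
      \<comment> \<open>f is now a multiple of an exponential, so a single zero, interior or at an
        endpoint, is enough.\<close>
      have "\<exists>x0. f x0 = 0"
      proof -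
        consider "card S > 0" | "i > 0" | "j > 0" using less.prems(9) Cons by fastforce
        then show ?thesis
        proof cases
          case 1
          then show ?thesis using less.prems(8) by (metis card_gt_0_iff ex_in_conv)
        next
          case 2
          then show ?thesis using less.prems(4) by (metis Dn.simps(1) vanish_def)
        next
          case 3
          then show ?thesis using less.prems(5) by (metis Dn.simps(1) vanish_def)
        qed
      qed
      then show ?thesis using dl_eq_zero_imp_zero[OF sm, of \<mu>] g0 g_def by auto
    next
      case False
      then have nz: "cnj \<mu> \<noteq> \<mu>" by (simp add: complex_eq_iff)
      have "cnj \<mu> \<in># image_mset cnj (mset \<mu>s)" using Cons by simp
      then have "cnj \<mu> \<in># mset \<mu>s" using less.prems(1) by (simp only: disconj_def)
      then have "cnj \<mu> \<in> set \<nu>s" using Cons nz by simp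
      define \<kappa>s where "\<kappa>s = remove1 (cnj \<mu>) \<nu>s"
      have eq: "mset \<mu>s = mset (\<mu> # cnj \<mu> # \<kappa>s)" using Cons \<open>cnj \<mu> \<in> set \<nu>s\<close> by (simp add: \<kappa>s_def)
      then have len: "length \<mu>s = length \<kappa>s + 2" using mset_eq_length[OF eq] by simp
      have dk: "disconj a b \<kappa>s"
        using less.prems(1) mset_eq_setD[OF eq] unfolding disconj_def eq
        by (auto simp: add_mset_commute)
      have "Espace \<mu>s = Espace (cnj \<mu> # \<mu> # \<kappa>s)" by (rule Espace_mset_cong) (simp add: eq)
      define g where "g = dl \<mu> (dl (cnj \<mu>) f)"
      have g: "g \<in> Espace \<kappa>s" unfolding g_def
        using less.prems(2) \<open>Espace \<mu>s = _\<close> Espace_dl by blast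
      have muab: "\<bar>Im \<mu>\<bar> * (b - a) < pi" using less.prems(1) Cons by (simp add: disconj_def)
      have "cnj (f x) = f x" for x using less.prems(3) by (simp add: complex_eq_iff)
      \<comment> \<open>Conjugation exchanges the two commuting factors, so \<open>g\<close> is
        real-valued.\<close>
      then have "cnj (dl (cnj \<mu>) f x) = dl \<mu> f x" for x
        using dl_cnj[OF sm, of "cnj \<mu>"] by (simp add: fun_eq_iff)
      then have "cnj (g x) = g x" for x
        using dl_cnj[OF smooth_dl(1)[OF sm], of \<mu> "cnj \<mu>"] dl_commute[OF sm, of \<mu> "cnj \<mu>"]
        by (simp add: g_def fun_eq_iff)
      then have Img: "Im (g x) = 0" for x by (metis Reals_cnj_iff complex_is_Real_iff)
      obtain T where T: "finite T" "T \<subseteq> {a<..<b}" "\<And>x. x \<in> T \<Longrightarrow> Re (g x) = 0"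
          "card S + i + j \<le> card T + (i - 2) + (j - 2) + 2"
        using zeros_dl_pair[OF sm less.prems(3) ab muab less.prems(4-8)] by (auto simp: g_def)
      have g0: "g = (\<lambda>_. 0)"
      proof (rule less.hyps[OF _ dk g Img])
        show "vanish g a (i - 2)" "vanish g b (j - 2)"
          using vanish_dl[OF smooth_dl(1)[OF sm] vanish_dl[OF sm less.prems(4)]]
            vanish_dl[OF smooth_dl(1)[OF sm] vanish_dl[OF sm less.prems(5)]]
          by (simp_all add: g_def numeral_2_eq_2)
        show "g x = 0" if "x \<in> T" for x using T(3)[OF that] Img by (simp add: complex_eq_iff)
        show "length \<kappa>s \<le> card T + (i - 2) + (j - 2)" using T(4) less.prems(9) len by simp
      qed (use len T in auto)
      then have "dl (cnj \<mu>) f \<in> Espace [\<mu>]"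
        unfolding g_def by (simp add: Espace_def dl_def smooth_dl(1)[OF sm, unfolded dl_def])
      then have ker: "f \<in> Espace [\<mu>, cnj \<mu>]"
        using Espace_Cons_iff[OF sm, of "cnj \<mu>" "[\<mu>]"]
          Espace_mset_cong[of "[\<mu>, cnj \<mu>]" "[cnj \<mu>, \<mu>]"] by simp
      \<comment> \<open>In the kernel of the pair two zeros suffice: either two distinct ones in
        [a,b], collected in \<open>Z\<close>, or a double zero at an endpoint.\<close>
      define Z where "Z = S \<union> endpts a b i j 1"
      have Z: "Z \<subseteq> {a..b}" "\<And>x. x \<in> Z \<Longrightarrow> f x = 0"
        using less.prems(4,5,7,8) ab
        by (auto simp: Z_def endpts_def vanish_def split: if_splits)
      have "card Z = card S + card (endpts a b i j 1)"
        unfolding Z_def using less.prems(7)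
        by (intro card_Un_disjoint less.prems(6)) (auto simp: endpts_def)
      moreover have "card (endpts a b i j 1) = min i 1 + min j 1"
        using ab by (auto simp: endpts_def min_def)
      moreover have "2 \<le> card S + i + j" using less.prems(9) len by simp
      ultimately consider "2 \<le> card Z" | "2 \<le> i" | "2 \<le> j" by linarith
      then show ?thesis
      proof cases
        case 1
        then have "finite Z" "\<not> card Z \<le> Suc 0" by (auto intro: card_ge_0_finite)
        then obtain x0 x1 where "x0 \<in> Z" "x1 \<in> Z" "x0 \<noteq> x1"
          using card_le_Suc0_iff_eq by blast
        then show ?thesis using Espace_pair_two_zeros[OF ker False muab, of x0 x1] Z by blast
      next
        case 2
        then show ?thesis using Espace_vanish_imp_zero[OF ker vanish_mono[OF less.prems(4)]] by simp
      next
        case 3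
        then show ?thesis using Espace_vanish_imp_zero[OF ker vanish_mono[OF less.prems(5)]] by simp
      qed
    qed
  qed
qed

text \<open>For complex f, the real case with \<open>S\<close> empty applies to f + cnj f and \<i>
  (f - cnj f), which are real multiples of Re f and Im f.\<close>

lemma vanish_imp_zero:
  assumes "disconj a b \<mu>s" "f \<in> Espace \<mu>s" "vanish f a i" "vanish f b j" "length \<mu>s \<le> i + j"
  shows "f = (\<lambda>_. 0)"
proof -
  have sm: "smooth f" using assms Espace_smooth by blast
  have cf: "(\<lambda>x. cnj (f x)) \<in> Espace \<mu>s"
    using Espace_cnj[OF assms(2)] Espace_mset_cong[of "map cnj \<mu>s" \<mu>s] assms(1)
    by (simp add: disconj_def)
  have vc: "vanish (\<lambda>x. cnj (f x)) a i" "vanish (\<lambda>x. cnj (f x)) b j"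
    using assms by (auto simp: vanish_def smooth_cnj[OF sm])
  have *: "(\<lambda>x. c * f x + d * cnj (f x)) = (\<lambda>_. 0)"
    if "\<And>x. Im (c * f x + d * cnj (f x)) = 0" for c d
    using real_zeros_imp_zero[OF assms(1) Espace_lincomb[OF assms(2) cf] that, of i j "{}"]
      vanish_lincomb[OF sm smooth_cnj(1)[OF sm]] assms(3-5) vc by auto
  have "f x + cnj (f x) = 0" "\<i> * f x - \<i> * cnj (f x) = 0" for x
    using *[of 1 1] *[of "\<i>" "-\<i>"] by (simp_all add: fun_eq_iff)
  then show ?thesis by (auto simp: fun_eq_iff complex_eq_iff)
qed

section \<open>Bernstein bases\<close>

text \<open>l'Hospital's rule applied r times; the induction replaces the sequence \<open>u\<close>
  by its shift. The complex version below treats real and imaginary parts separately.\<close>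

lemma tendsto_div_power_real:
  fixes u :: "nat \<Rightarrow> real \<Rightarrow> real"
  assumes "\<And>k x. (u k has_real_derivative u (Suc k) x) (at x)"
    and "\<And>j. j < r \<Longrightarrow> u j c = 0"
  shows "((\<lambda>x. u 0 x / (x - c) ^ r) \<longlongrightarrow> u r c / fact r) (at c)"
  using assms
proof (induction r arbitrary: u)
  case 0
  then have "isCont (u 0) c" using DERIV_isCont by blast
  then show ?case by (simp add: isCont_def)
next
  case (Suc r)
  have cont: "(u 0 \<longlongrightarrow> 0) (at c)"
  proof -
    have "isCont (u 0) c" using DERIV_isCont Suc.prems(1) by blast
    then show ?thesis using Suc.prems(2)[of 0] by (simp add: isCont_def)
  qed
  have "((\<lambda>x. u (Suc 0) x / (x - c) ^ r) \<longlongrightarrow> u (Suc r) c / fact r) (at c)"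
    using Suc.IH[of "\<lambda>k. u (Suc k)"] Suc.prems by simp
  from tendsto_divide[OF this tendsto_const[of "of_nat (Suc r)"]]
  have lim: "((\<lambda>x. u (Suc 0) x / (of_nat (Suc r) * (x - c) ^ r)) \<longlongrightarrow> u (Suc r) c / fact (Suc r)) (at c)"
    by (simp add: mult_ac del: of_nat_Suc)
  show ?case
  proof (rule lhopital[OF cont _ _ _ _ _ lim])
    show "((\<lambda>x. (x - c) ^ Suc r) \<longlongrightarrow> 0) (at c)"
      by (rule tendsto_eq_intros refl)+ simp
    show "\<forall>\<^sub>F x in at c. (x - c) ^ Suc r \<noteq> 0" "\<forall>\<^sub>F x in at c. of_nat (Suc r) * (x - c) ^ r \<noteq> 0"
      by (rule eventually_mono[OF eventually_neq_at_within[of c c UNIV]], simp)+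
    show "\<forall>\<^sub>F x in at c. (u 0 has_real_derivative u (Suc 0) x) (at x)"
      using Suc.prems(1) by simp
    show "\<forall>\<^sub>F x in at c. ((\<lambda>x. (x - c) ^ Suc r) has_real_derivative of_nat (Suc r) * (x - c) ^ r) (at x)"
      by (intro always_eventually allI) (auto intro!: derivative_eq_intros simp del: power_Suc)
  qed
qed

lemma tendsto_Re_div_power:
  assumes "smooth f" "vanish f c r"
  shows "((\<lambda>x. Re (f x) / (x - c) ^ r) \<longlongrightarrow> Re (Dn r f c) / fact r) (at c)"
  using tendsto_div_power_real[of "\<lambda>k x. Re (Dn k f x)", OF Re_has_derivative[OF assms(1)]]
    assms(2) by (simp add: vanish_def)

lemma tendsto_div_power:
  assumes "smooth f" "vanish f c r"
  shows "((\<lambda>x. f x / complex_of_real ((x - c) ^ r)) \<longlongrightarrow> Dn r f c / fact r) (at c)"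
proof -
  have Im: "((\<lambda>x. Im (Dn k f x)) has_real_derivative Im (Dn (Suc k) f x)) (at x)" for k x
    using bounded_linear.has_vector_derivative[OF bounded_linear_Im
        smooth_has_vector_derivative[OF assms(1)]]
    by (simp add: has_real_derivative_iff_has_vector_derivative)
  note tendsto_Re_div_power[OF assms]
  moreover have "((\<lambda>x. Im (f x) / (x - c) ^ r) \<longlongrightarrow> Im (Dn r f c) / fact r) (at c)"
    using tendsto_div_power_real[of "\<lambda>k x. Im (Dn k f x)", OF Im] assms(2) by (simp add: vanish_def)
  moreover have "z / fact r = z / complex_of_real (fact r)" for z by simp
  ultimately show ?thesis
    unfolding tendsto_complex_iff by (simp only: Re_divide_of_real Im_divide_of_real)
qed

text \<open>Divide both functions by the same power of x - c. With c = b this evaluates every limit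
  in the theorem.\<close>

lemma tendsto_ratio:
  assumes "smooth f" "smooth g" "vanish f c r" "vanish g c r" "Dn r g c \<noteq> 0"
  shows "((\<lambda>x. f x / g x) \<longlongrightarrow> Dn r f c / Dn r g c) (at c)"
proof -
  have "((\<lambda>x. (f x / complex_of_real ((x - c) ^ r)) / (g x / complex_of_real ((x - c) ^ r)))
      \<longlongrightarrow> (Dn r f c / fact r) / (Dn r g c / fact r)) (at c)"
    using assms by (intro tendsto_divide tendsto_div_power) auto
  moreover have "\<forall>\<^sub>F x in at c. (f x / complex_of_real ((x - c) ^ r)) / (g x / complex_of_real ((x - c) ^ r)) = f x / g x"
    by (auto simp: eventually_at_filter simp del: of_real_power)
  ultimately have "((\<lambda>x. f x / g x) \<longlongrightarrow> (Dn r f c / fact r) / (Dn r g c / fact r)) (at c)"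
    by (rule Lim_transform_eventually)
  then show ?thesis by simp
qed

section \<open>Existence, uniqueness and sign of the Bernstein basis\<close>

text \<open>An exponential has order 0; solving (D - \<mu>) g = f with g a = 0 raises the order at a
  by exactly one while adding one exponent.\<close>

lemma Espace_order_at_point:
  assumes "i < length \<mu>s"
  shows "\<exists>f\<in>Espace \<mu>s. vanish f a i \<and> Dn i f a \<noteq> 0"
  using assms
proof (induction \<mu>s arbitrary: i)
  case Nil
  then show ?case by simp
next
  case (Cons \<mu> \<mu>s)
  show ?case
  proof (cases i)
    case 0
    show ?thesis
      by (rule bexI[of _ "\<lambda>x. exp (\<mu> * complex_of_real x)"])
        (simp_all add: 0 vanish_def exp_in_Espace_iff)
  next
    case (Suc i')
    then obtain f where f: "f \<in> Espace \<mu>s" "vanish f a i'" "Dn i' f a \<noteq> 0"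
      using Cons by auto
    obtain g where g: "smooth g" "g a = 0" "dl \<mu> g = f"
      using solve_dl[OF Espace_smooth[OF f(1)]] by metis
    have "g \<in> Espace (\<mu> # \<mu>s)" using Espace_Cons_iff g f by blast
    have D: "Dn (Suc k) g a = \<mu> * Dn k g a + Dn k f a" for k
      using fun_cong[OF smooth_dl(2)[OF g(1), of k \<mu>], of a] g(3) by simp
    have "Dn k g a = 0" if "k \<le> i'" for k
      using that
    proof (induction k)
      case 0
      then show ?case using g by simp
    next
      case (Suc k)
      then show ?case using D f(2) by (simp add: vanish_def del: Dn.simps(2))
    qed
    then have "vanish g a i" "Dn i g a \<noteq> 0"
      using D[of i'] f(3) Suc by (auto simp: vanish_def less_Suc_eq_le simp del: Dn.simps(2))
    then show ?thesis using \<open>g \<in> Espace (\<mu> # \<mu>s)\<close> by blast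
  qed
qed

text \<open>Existence half of the Bernstein basis: the exact order i at a is kept while the order at
  b is raised one unit at a time.\<close>

lemma Espace_two_point_order:
  assumes "disconj a b \<mu>s"
  shows "i + j < length \<mu>s \<Longrightarrow> \<exists>f\<in>Espace \<mu>s. vanish f a i \<and> Dn i f a \<noteq> 0 \<and> vanish f b j"
proof (induction j arbitrary: i)
  case 0
  then show ?case using Espace_order_at_point[of i \<mu>s a] by (auto simp: vanish_def)
next
  case (Suc j)
  then obtain f where f: "f \<in> Espace \<mu>s" "vanish f a i" "Dn i f a \<noteq> 0" "vanish f b j"
    using Suc.IH[of i] by (metis Suc_lessD add_Suc_right)
  txt \<open>Subtract a multiple of the element of maximal order at a: it vanishes there to higher order
    than i, and by the Chebyshev property its order at b is exactly j.\<close>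
  define l where "l = length \<mu>s - 1 - j"
  have l: "i < l" "l + j < length \<mu>s" "length \<mu>s \<le> l + Suc j" using Suc.prems by (auto simp: l_def)
  obtain g where g: "g \<in> Espace \<mu>s" "vanish g a l" "Dn l g a \<noteq> 0" "vanish g b j"
    using Suc.IH[OF l(2)] by auto
  have gb: "Dn j g b \<noteq> 0"
  proof
    assume "Dn j g b = 0"
    then have "g = (\<lambda>_. 0)" using vanish_imp_zero[OF assms g(1,2), of "Suc j"] g(4) l by (simp add: vanish_Suc)
    then show False using g(3) by (simp add: Dn_zero)
  qed
  define h where "h = (\<lambda>x. 1 * f x + (- (Dn j f b / Dn j g b)) * g x)"
  note sm = Espace_smooth[OF f(1)] Espace_smooth[OF g(1)]
  have "h \<in> Espace \<mu>s" unfolding h_def by (intro Espace_lincomb f g)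
  moreover have "vanish h a i"
    unfolding h_def using vanish_mono[OF g(2), of i] l(1) by (intro vanish_lincomb sm f) auto
  moreover have "Dn i g a = 0" using g(2) l(1) by (simp add: vanish_def)
  then have "Dn i h a \<noteq> 0" unfolding h_def smooth_lincomb(2)[OF sm] using f(3) by simp
  moreover have "vanish h b j" unfolding h_def by (intro vanish_lincomb sm f g)
  moreover have "Dn j h b = 0" unfolding h_def smooth_lincomb(2)[OF sm] using gb by simp
  ultimately show ?case by (auto simp: vanish_Suc)
qed

text \<open>Uniqueness half: equal k-th derivatives give the difference order k + 1 at a, and the
  total order then reaches the dimension.\<close>

lemma vanish_bern_eqI:
  assumes "disconj a b \<mu>s" "f \<in> Espace \<mu>s" "g \<in> Espace \<mu>s" "k < length \<mu>s"
    and "vanish f a k" "vanish f b (length \<mu>s - 1 - k)"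
    and "vanish g a k" "vanish g b (length \<mu>s - 1 - k)" "Dn k f a = Dn k g a"
  shows "f = g"
proof -
  note sm = Espace_smooth[OF assms(2)] Espace_smooth[OF assms(3)]
  have "(\<lambda>x. f x - g x) = (\<lambda>_. 0)"
  proof (rule vanish_imp_zero[OF assms(1) Espace_diff[OF assms(2,3)]])
    show "vanish (\<lambda>x. f x - g x) a (Suc k)"
      using vanish_diff[OF sm assms(5,7)] assms(9) by (simp add: vanish_Suc smooth_diff[OF sm])
    show "vanish (\<lambda>x. f x - g x) b (length \<mu>s - 1 - k)" using vanish_diff[OF sm assms(6,8)] .
    show "length \<mu>s \<le> Suc k + (length \<mu>s - 1 - k)" using assms(4) by simp
  qed
  then show ?thesis by (auto simp: fun_eq_iff)
qed

text \<open>\<open>bern\<close> is a definite description, so its properties need existence and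
  uniqueness. Exactness of the order at b is automatic, since one more order would force the zero
  function.\<close>

lemma bern_spec:
  assumes "disconj a b \<mu>s" "k < length \<mu>s"
  shows bern_in_Espace: "bern \<mu>s a b k \<in> Espace \<mu>s"
    and bern_vanish_left: "vanish (bern \<mu>s a b k) a k"
    and bern_left: "Dn k (bern \<mu>s a b k) a = 1"
    and bern_vanish_right: "vanish (bern \<mu>s a b k) b (length \<mu>s - 1 - k)"
    and bern_right: "Dn (length \<mu>s - 1 - k) (bern \<mu>s a b k) b \<noteq> 0"
proof -
  define r where "r = length \<mu>s - 1 - k"
  have r: "k + r < length \<mu>s" "length \<mu>s \<le> k + Suc r" using assms(2) by (auto simp: r_def)
  obtain f where f: "f \<in> Espace \<mu>s" "vanish f a k" "Dn k f a \<noteq> 0" "vanish f b r"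
    using Espace_two_point_order[OF assms(1) r(1)] by blast
  have fb: "Dn r f b \<noteq> 0"
  proof
    assume "Dn r f b = 0"
    then have "f = (\<lambda>_. 0)"
      using vanish_imp_zero[OF assms(1) f(1,2), of "Suc r"] f(4) r by (simp add: vanish_Suc)
    then show False using f(3) by (simp add: Dn_zero)
  qed
  let ?Q = "\<lambda>p. p \<in> Espace \<mu>s \<and> zero_order p a k \<and> zero_order p b (length \<mu>s - 1 - k) \<and> Dn k p a = 1"
  define p where "p = (\<lambda>x. 1 / Dn k f a * f x)"
  have "?Q p"
    unfolding p_def zero_order_def smooth_scale(2)[OF Espace_smooth[OF f(1)]] r_def[symmetric]
    using f fb Espace_scale[OF f(1), of "1 / Dn k f a"] by (auto simp: vanish_def)
  moreover have "q = p" if "?Q q" for q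
    using that \<open>?Q p\<close> vanish_bern_eqI[OF assms(1) _ _ assms(2), of q p]
    by (auto simp: zero_order_def vanish_def)
  ultimately have "?Q (bern \<mu>s a b k)" unfolding bern_def by (rule theI)
  then show "bern \<mu>s a b k \<in> Espace \<mu>s" "vanish (bern \<mu>s a b k) a k" "Dn k (bern \<mu>s a b k) a = 1"
    "vanish (bern \<mu>s a b k) b (length \<mu>s - 1 - k)" "Dn (length \<mu>s - 1 - k) (bern \<mu>s a b k) b \<noteq> 0"
    by (auto simp: zero_order_def vanish_def)
qed

lemma bern_smooth: "disconj a b \<mu>s \<Longrightarrow> k < length \<mu>s \<Longrightarrow> smooth (bern \<mu>s a b k)"
  using bern_in_Espace Espace_smooth by blast

text \<open>Main recognition device: lower bounds on the orders at both endpoints determine a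
  function up to its k-th derivative at a.\<close>

lemma vanish_imp_bern_multiple:
  assumes "disconj a b \<mu>s" "f \<in> Espace \<mu>s" "k < length \<mu>s"
    and "vanish f a k" "vanish f b (length \<mu>s - 1 - k)"
  shows "f = (\<lambda>x. Dn k f a * bern \<mu>s a b k x)"
proof -
  note B = bern_spec[OF assms(1,3)] and sm = bern_smooth[OF assms(1,3)]
  show ?thesis
  proof (rule vanish_bern_eqI[OF assms(1,2) _ assms(3-5)])
    show "(\<lambda>x. Dn k f a * bern \<mu>s a b k x) \<in> Espace \<mu>s" by (rule Espace_scale[OF B(1)])
  qed (use B in \<open>auto simp: vanish_def smooth_scale(2)[OF sm]\<close>)
qed

text \<open>Conjugation preserves the space and all normalising conditions, so uniqueness makes the
  basis real-valued.\<close>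

lemma Dn_bern_real:
  assumes "disconj a b \<mu>s" "k < length \<mu>s"
  shows "Im (Dn j (bern \<mu>s a b k) x) = 0"
proof -
  note B = bern_spec[OF assms] and sm = bern_smooth[OF assms]
  have "(\<lambda>x. cnj (bern \<mu>s a b k x)) = bern \<mu>s a b k"
  proof (rule vanish_bern_eqI[OF assms(1) _ B(1) assms(2)])
    show "(\<lambda>x. cnj (bern \<mu>s a b k x)) \<in> Espace \<mu>s"
      using Espace_cnj[OF B(1)] Espace_mset_cong[of "map cnj \<mu>s" \<mu>s] assms(1)
      by (simp add: disconj_def)
  qed (use B in \<open>auto simp: vanish_def smooth_cnj(2)[OF sm]\<close>)
  then have "cnj (Dn j (bern \<mu>s a b k) x) = Dn j (bern \<mu>s a b k) x"
    using smooth_cnj(2)[OF sm, of j] by (metis)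
  then show ?thesis by (metis Reals_cnj_iff complex_is_Real_iff)
qed

text \<open>An interior zero would exceed the Chebyshev bound. The normalisation at a gives positive
  values just to the right of a, and the intermediate value theorem carries the sign over the
  interval.\<close>

lemma bern_pos:
  assumes "disconj a b \<mu>s" "k < length \<mu>s" "a < x" "x < b"
  shows "Re (bern \<mu>s a b k x) > 0"
proof -
  define p where "p = bern \<mu>s a b k"
  note B = bern_spec[OF assms(1,2), folded p_def] and sm = bern_smooth[OF assms(1,2), folded p_def]
  have Im0: "Im (p x) = 0" for x using Dn_bern_real[OF assms(1,2), of 0] by (simp add: p_def)
  have nz: "Re (p z) \<noteq> 0" if "a < z" "z < b" for z
  proof
    assume "Re (p z) = 0"
    then have "p z = 0" using Im0 by (simp add: complex_eq_iff)
    then have "p = (\<lambda>_. 0)"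
      using real_zeros_imp_zero[OF assms(1) B(1) Im0 B(2,4), of "{z}"] assms(2) that by simp
    then show False using B(3) by (simp add: Dn_zero)
  qed
  have lim: "((\<lambda>x. Re (p x) / (x - a) ^ k) \<longlongrightarrow> 1 / fact k) (at_right a)"
    using tendsto_Re_div_power[OF sm B(2)] B(3) by (simp add: filterlim_at_split)
  have "\<forall>\<^sub>F x in at_right a. Re (p x) / (x - a) ^ k > 0"
    using order_tendstoD(1)[OF lim, of 0] by simp
  moreover have "\<forall>\<^sub>F y in at_right a. y \<in> {a<..<x}"
    using eventually_at_right_real[OF assms(3)] .
  ultimately have "\<forall>\<^sub>F y in at_right a. Re (p y) / (y - a) ^ k > 0 \<and> y \<in> {a<..<x}"
    by (rule eventually_conj)
  from eventually_happens'[OF trivial_limit_at_right_real this]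
  obtain y where "Re (p y) / (y - a) ^ k > 0" "a < y" "y < x" by auto
  then have y: "Re (p y) > 0" by (simp add: zero_less_divide_iff)
  show ?thesis
  proof (rule ccontr)
    assume "\<not> ?thesis"
    then have "Re (p x) \<le> 0" by (simp add: p_def)
    then have "\<exists>z. y \<le> z \<and> z \<le> x \<and> Re (p z) = 0"
      using y \<open>y < x\<close> DERIV_isCont[OF Re_has_derivative[OF sm, of 0]]
      by (intro IVT2) auto
    then obtain z where "y \<le> z" "z \<le> x" "Re (p z) = 0" by blast
    then show False using nz[of z] \<open>a < y\<close> assms(4) by simp
  qed
qed

text \<open>Positivity on (a,b) and the sign (-1)^r of (x - b)^r to the left of b give the weak
  inequality in the limit; exactness of the order at b makes it strict.\<close>

lemma bern_right_sign:
  assumes "disconj a b \<mu>s" "k < length \<mu>s" "r = length \<mu>s - 1 - k"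
  shows "(- 1) ^ r * Re (Dn r (bern \<mu>s a b k) b) > 0"
proof -
  define p where "p = bern \<mu>s a b k"
  note B = bern_spec[OF assms(1,2), folded p_def assms(3)]
    and sm = bern_smooth[OF assms(1,2), folded p_def]
  have ab: "a < b" using assms(1) by (simp add: disconj_def)
  have "((\<lambda>x. Re (p x) / (x - b) ^ r) \<longlongrightarrow> Re (Dn r p b) / fact r) (at_left b)"
    using tendsto_Re_div_power[OF sm B(4)] by (simp add: filterlim_at_split)
  then have lim: "((\<lambda>x. (- 1) ^ r * (Re (p x) / (x - b) ^ r)) \<longlongrightarrow> (- 1) ^ r * (Re (Dn r p b) / fact r)) (at_left b)"
    by (intro tendsto_mult_left)
  have "\<forall>\<^sub>F x in at_left b. x \<in> {a<..<b}" using eventually_at_left_real[OF ab] .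
  then have "\<forall>\<^sub>F x in at_left b. (- 1) ^ r * (Re (p x) / (x - b) ^ r) \<ge> 0"
  proof (rule eventually_mono)
    fix x assume "x \<in> {a<..<b}"
    then have "Re (p x) / (b - x) ^ r > 0" using bern_pos[OF assms(1,2)] by (simp add: p_def)
    moreover have "(b - x) ^ r = (- 1) ^ r * (x - b) ^ r"
      using power_minus[of "x - b" r] by simp
    ultimately have *: "Re (p x) / ((- 1) ^ r * (x - b) ^ r) > 0" by simp
    show "(- 1) ^ r * (Re (p x) / (x - b) ^ r) \<ge> 0"
    proof (cases "even r")
      case True
      then show ?thesis using less_imp_le[OF *] by simp
    next
      case False
      then show ?thesis using less_imp_le[OF *] by simp
    qed
  qed
  then have "(- 1) ^ r * (Re (Dn r p b) / fact r) \<ge> 0"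
    by (rule tendsto_lowerbound[OF lim]) simp
  then have "(- 1) ^ r * Re (Dn r p b) \<ge> 0"
    using mult_nonneg_nonneg[of "(- 1) ^ r * (Re (Dn r p b) / fact r)" "fact r"] by simp
  moreover have "Re (Dn r p b) \<noteq> 0"
    using B(5) Dn_bern_real[OF assms(1,2), of r b] by (auto simp: complex_eq_iff p_def)
  then have "(- 1) ^ r * Re (Dn r p b) \<noteq> 0" by simp
  ultimately show ?thesis unfolding p_def by linarith
qed

section \<open>Expansion of exponentials\<close>

text \<open>Up to a factorial, the leading Taylor coefficient at b. Under \<open>disconj\<close> the
  derivative is real by \<open>Dn_bern_real\<close>, so \<open>Re\<close> loses nothing; the limits
  in the theorem become quotients of such values.\<close>

definition lead :: "real \<Rightarrow> real \<Rightarrow> complex list \<Rightarrow> nat \<Rightarrow> real" where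
  "lead a b \<mu>s k = Re (Dn (length \<mu>s - 1 - k) (bern \<mu>s a b k) b)"

lemma bern_right_eq_lead:
  assumes "disconj a b \<mu>s" "k < length \<mu>s" "r = length \<mu>s - 1 - k"
  shows "Dn r (bern \<mu>s a b k) b = complex_of_real (lead a b \<mu>s k)"
  using Dn_bern_real[OF assms(1,2), of r b] assms(3) by (simp add: lead_def complex_eq_iff)

lemma lead_sign:
  assumes "disconj a b \<mu>s" "k < length \<mu>s" "r = length \<mu>s - 1 - k"
  shows "(- 1) ^ r * lead a b \<mu>s k > 0"
  using bern_right_sign[OF assms] assms(3) by (simp add: lead_def)

lemma lead_nonzero: "disconj a b \<mu>s \<Longrightarrow> k < length \<mu>s \<Longrightarrow> lead a b \<mu>s k \<noteq> 0"
  using lead_sign by fastforce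

lemma lead_div_pos:
  assumes "disconj a b \<mu>s" "k < length \<mu>s" "disconj a b \<nu>s" "l < length \<nu>s"
    and "length \<mu>s - 1 - k = length \<nu>s - 1 - l"
  shows "lead a b \<mu>s k / lead a b \<nu>s l > 0"
proof -
  note lead_sign[OF assms(1,2) refl] lead_sign[OF assms(3,4) refl]
  then show ?thesis unfolding assms(5)
    by (cases "even (length \<nu>s - 1 - l)") (auto simp: divide_pos_pos divide_neg_neg)
qed

lemma lead_div_neg:
  assumes "disconj a b \<mu>s" "k < length \<mu>s" "disconj a b \<nu>s" "l < length \<nu>s"
    and "length \<mu>s - 1 - k = Suc (length \<nu>s - 1 - l)"
  shows "lead a b \<mu>s k / lead a b \<nu>s l < 0"
proof -
  note lead_sign[OF assms(1,2) refl] lead_sign[OF assms(3,4) refl]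
  then show ?thesis unfolding assms(5)
    by (cases "even (length \<nu>s - 1 - l)") (auto simp: divide_neg_pos divide_pos_neg)
qed

lemma bern_mset_cong:
  assumes "mset xs = mset ys"
  shows "bern xs = bern ys"
  using Espace_mset_cong[OF assms] mset_eq_length[OF assms] by (auto simp: bern_def fun_eq_iff)

lemma disconj_mset_cong:
  assumes "mset xs = mset ys"
  shows "disconj a b xs \<longleftrightarrow> disconj a b ys"
  using assms mset_eq_setD[OF assms] by (auto simp: disconj_def)

lemma lead_mset_cong: "mset xs = mset ys \<Longrightarrow> lead a b xs = lead a b ys"
  unfolding lead_def using bern_mset_cong[of xs ys] mset_eq_length[of xs ys] by simp

text \<open>Differentiation lowers the order at b by one, to that of the k-th basis function for the
  tail, so the ratio has a finite limit.\<close>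

lemma Dx_bern_ratio_tendsto:
  assumes "disconj a b (\<mu> # \<mu>s)" "Im \<mu> = 0" "k < length \<mu>s"
  shows "((\<lambda>x. Dx (bern (\<mu> # \<mu>s) a b k) x / bern \<mu>s a b k x)
    \<longlongrightarrow> complex_of_real (lead a b (\<mu> # \<mu>s) k / lead a b \<mu>s k)) (at_left b)"
proof -
  define r where "r = length \<mu>s - 1 - k"
  define P where "P = bern (\<mu> # \<mu>s) a b k"
  have d: "disconj a b \<mu>s" using disconj_real_tail assms by blast
  have k: "k < length (\<mu> # \<mu>s)" "Suc r = length (\<mu> # \<mu>s) - 1 - k" using assms(3) by (auto simp: r_def)
  have smP: "smooth P" unfolding P_def by (rule bern_smooth[OF assms(1) k(1)])
  have vP: "vanish P b (Suc r)" unfolding P_def k(2) by (rule bern_vanish_right[OF assms(1) k(1)])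
  have "((\<lambda>x. Dx P x / bern \<mu>s a b k x) \<longlongrightarrow> Dn r (Dx P) b / Dn r (bern \<mu>s a b k) b) (at b)"
  proof (rule tendsto_ratio[OF smooth_Dx[OF smP] bern_smooth[OF d assms(3)]])
    show "vanish (Dx P) b r" using vP unfolding vanish_def Dn_Dx by blast
    show "vanish (bern \<mu>s a b k) b r" "Dn r (bern \<mu>s a b k) b \<noteq> 0"
      unfolding r_def using bern_vanish_right[OF d assms(3)] bern_right[OF d assms(3)] by auto
  qed
  then show ?thesis
    unfolding Dn_Dx P_def bern_right_eq_lead[OF assms(1) k] bern_right_eq_lead[OF d assms(3) r_def]
    by (simp add: filterlim_at_split)
qed

text \<open>The image of \<open>P k\<close> has order at least k - 1 at a with leading derivative 1,
  so subtracting \<open>Q (k - 1)\<close> gains an order there; at b nothing is lost because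
  \<open>Q (k - 1)\<close> vanishes to one order more than \<open>Q k\<close>. What remains is a
  multiple of \<open>Q k\<close>.\<close>

lemma dl_bern:
  fixes P Q :: "nat \<Rightarrow> real \<Rightarrow> complex"
  assumes "disconj a b (\<mu> # \<mu>s)" "Im \<mu> = 0"
  defines "P \<equiv> bern (\<mu> # \<mu>s) a b" and "Q \<equiv> bern \<mu>s a b"
  shows "k < length \<mu>s \<Longrightarrow> dl \<mu> (P k) x = (if k = 0 then 0 else Q (k - 1) x)
      + complex_of_real (lead a b (\<mu> # \<mu>s) k / lead a b \<mu>s k) * Q k x"
    and "\<mu>s \<noteq> [] \<Longrightarrow> dl \<mu> (P (length \<mu>s)) x = Q (length \<mu>s - 1) x"
proof -
  have d: "disconj a b \<mu>s" using disconj_real_tail assms by blast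
  show "dl \<mu> (P k) x = (if k = 0 then 0 else Q (k - 1) x)
      + complex_of_real (lead a b (\<mu> # \<mu>s) k / lead a b \<mu>s k) * Q k x" if kl: "k < length \<mu>s"
  proof -
    define r where "r = length \<mu>s - 1 - k"
    have k: "k < length (\<mu> # \<mu>s)" "Suc r = length (\<mu> # \<mu>s) - 1 - k" using kl by (auto simp: r_def)
    note BP = bern_spec[OF assms(1) k(1), folded P_def k(2)]
    note BQ = bern_spec[OF d kl, folded Q_def r_def]
    have smP: "smooth (P k)" using BP(1) Espace_smooth by blast
    have smQ: "smooth (Q k)" using BQ(1) Espace_smooth by blast
    define h where "h = dl \<mu> (P k)"
    \<comment> \<open>The zero function stands in for the missing predecessor of \<open>Q 0\<close>,
      so that one argument covers k = 0 as well.\<close>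
    define q where "q = (if k = 0 then (\<lambda>_. 0) else Q (k - 1))"
    have h: "h \<in> Espace \<mu>s" unfolding h_def by (rule Espace_dl[OF BP(1)])
    have Dh: "Dn j h x = Dn (Suc j) (P k) x - \<mu> * Dn j (P k) x" for j x
      unfolding h_def smooth_dl(2)[OF smP] by simp
    have q: "q \<in> Espace \<mu>s \<and> vanish q b (Suc r) \<and> vanish q a (k - 1) \<and> (k > 0 \<longrightarrow> Dn (k - 1) q a = 1)"
    proof (cases k)
      case 0
      then show ?thesis by (simp add: q_def Espace_zero vanish_zero)
    next
      case (Suc j)
      then have "j < length \<mu>s" "length \<mu>s - 1 - j = Suc r" using kl by (auto simp: r_def)
      then show ?thesis using bern_spec[OF d, of j] Suc by (simp add: q_def Q_def)
    qed
    have smq: "smooth q" using q Espace_smooth by blast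
    define g where "g = (\<lambda>x. h x - q x)"
    have Dg: "Dn j g x = Dn j h x - Dn j q x" for j x
      unfolding g_def smooth_diff(2)[OF Espace_smooth[OF h] smq] by simp
    have g: "g \<in> Espace \<mu>s" unfolding g_def using h q by (intro Espace_diff) auto
    have "vanish g a k"
    proof (cases k)
      case 0
      then show ?thesis by (simp add: vanish_def)
    next
      case (Suc j)
      have "Dn i g a = 0" if "i < j" for i
        using that BP(2) q Suc unfolding Dg Dh by (simp add: vanish_def del: Dn.simps(2))
      moreover have "Dn j g a = 0"
        using BP(2,3) q Suc unfolding Dg Dh by (simp add: vanish_def del: Dn.simps(2))
      ultimately show ?thesis using Suc by (simp add: vanish_def less_Suc_eq del: Dn.simps(2))
    qed
    moreover have "vanish g b r"
      using BP(4) q unfolding vanish_def Dg Dh by (auto simp del: Dn.simps(2))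
    ultimately have eq: "g = (\<lambda>x. Dn k g a * Q k x)"
      unfolding Q_def r_def by (rule vanish_imp_bern_multiple[OF d g kl])
    \<comment> \<open>The multiple is read off at b, where \<mu> times \<open>P k\<close> and
      \<open>q\<close> contribute nothing to the r-th derivative.\<close>
    have "Dn r g b = Dn (Suc r) (P k) b"
      using BP(4) q unfolding Dg Dh by (simp add: vanish_def del: Dn.simps(2))
    moreover have "Dn r g b = Dn k g a * Dn r (Q k) b"
      by (subst eq) (simp add: smooth_scale(2)[OF smQ])
    ultimately have "Dn k g a = Dn (Suc r) (P k) b / Dn r (Q k) b" using BQ(5) by (simp add: field_simps del: Dn.simps(2))
    also have "\<dots> = complex_of_real (lead a b (\<mu> # \<mu>s) k / lead a b \<mu>s k)"
      unfolding P_def Q_def bern_right_eq_lead[OF assms(1) k] bern_right_eq_lead[OF d kl r_def] by simp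
    finally have "g x = complex_of_real (lead a b (\<mu> # \<mu>s) k / lead a b \<mu>s k) * Q k x"
      using fun_cong[OF eq, of x] by simp
    then show ?thesis by (auto simp: g_def h_def q_def algebra_simps)
  qed
  show "dl \<mu> (P (length \<mu>s)) x = Q (length \<mu>s - 1) x" if "\<mu>s \<noteq> []"
  proof -
    define j where "j = length \<mu>s - 1"
    have j: "length \<mu>s = Suc j" using that by (simp add: j_def)
    have l: "Suc j < length (\<mu> # \<mu>s)" "j < length \<mu>s" using j by auto
    note BP = bern_spec[OF assms(1) l(1), folded P_def] and BQ = bern_spec[OF d l(2), folded Q_def]
    have smP: "smooth (P (Suc j))" using BP(1) Espace_smooth by blast
    \<comment> \<open>At the top index no order at b is prescribed for \<open>Q j\<close>, so order
      and normalisation at a alone identify the image.\<close>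
    have "dl \<mu> (P (Suc j)) = Q j"
    proof (rule vanish_bern_eqI[OF d Espace_dl[OF BP(1)] BQ(1)])
      show "vanish (dl \<mu> (P (Suc j))) a j" using vanish_dl[OF smP BP(2)] by simp
      show "Dn j (dl \<mu> (P (Suc j))) a = Dn j (Q j) a"
        using BP(2,3) BQ(3) by (simp add: smooth_dl(2)[OF smP] vanish_def del: Dn.simps(2))
    qed (use BQ j in \<open>simp_all add: vanish_def\<close>)
    then show ?thesis by (simp add: j)
  qed
qed

text \<open>The recursion cancels the coefficient of each tail basis function in the image under D -
  \<mu>, so the sum is a multiple of exp (\<mu> x); \<open>c 0\<close> fixes the factor at a, where
  only the basis function of index 0 is nonzero.\<close>

lemma exp_bern_expansion:
  fixes c :: "nat \<Rightarrow> real"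
  assumes d: "disconj a b (\<mu> # \<mu>s)" and \<mu>: "Im \<mu> = 0" and ne: "\<mu>s \<noteq> []"
    and c0: "c 0 = exp (Re \<mu> * a)"
    and c: "\<And>k. k < length \<mu>s \<Longrightarrow> c (Suc k) = - (lead a b (\<mu> # \<mu>s) k / lead a b \<mu>s k) * c k"
  shows "(\<Sum>k<Suc (length \<mu>s). complex_of_real (c k) * bern (\<mu> # \<mu>s) a b k x) = exp (\<mu> * complex_of_real x)"
proof -
  define m where "m = length \<mu>s"
  define P where "P = bern (\<mu> # \<mu>s) a b"
  define Q where "Q = bern \<mu>s a b"
  note dlP = dl_bern[OF d \<mu>, folded P_def Q_def m_def]
  have smP: "smooth (P k)" if "k < Suc m" for k
    unfolding P_def using bern_smooth[OF d] that by (simp add: m_def)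
  define f where "f = (\<lambda>x. \<Sum>k<Suc m. complex_of_real (c k) * P k x)"
  have smf: "smooth f" and Df: "\<And>j. Dn j f = (\<lambda>x. \<Sum>k<Suc m. complex_of_real (c k) * Dn j (P k) x)"
    unfolding f_def using smooth_sum[of "Suc m" P "\<lambda>k. complex_of_real (c k)"] smP by blast+
  \<comment> \<open>Partial sums telescope to a single term, which the top summand finally
    cancels.\<close>
  have tele: "(\<Sum>k<Suc j. complex_of_real (c k) * dl \<mu> (P k) x) = - complex_of_real (c (Suc j)) * Q j x"
    if "j < m" for j x
    using that
  proof (induction j)
    case 0
    then show ?case using dlP(1)[of 0 x] c[of 0] by (simp add: m_def)
  next
    case (Suc j)
    have "(\<Sum>k<Suc (Suc j). complex_of_real (c k) * dl \<mu> (P k) x)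
        = - complex_of_real (c (Suc j)) * Q j x + complex_of_real (c (Suc j)) * dl \<mu> (P (Suc j)) x"
      using Suc by simp
    then show ?case
      using dlP(1)[of "Suc j" x] c[of "Suc j"] Suc.prems by (simp add: m_def algebra_simps)
  qed
  have dlf: "dl \<mu> f = (\<lambda>_. 0)"
  proof
    fix x
    have "dl \<mu> f x = (\<Sum>k<Suc m. complex_of_real (c k) * dl \<mu> (P k) x)"
      using Df[of 1] by (simp add: dl_def f_def sum_subtractf sum_distrib_left algebra_simps)
    also obtain j where j: "m = Suc j" using ne by (cases m) (auto simp: m_def)
    have "(\<Sum>k<Suc m. complex_of_real (c k) * dl \<mu> (P k) x)
        = - complex_of_real (c (Suc j)) * Q j x + complex_of_real (c m) * dl \<mu> (P m) x"
      using tele[of j x] j by simp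
    also have "\<dots> = 0" using dlP(2)[OF ne, of x] j by simp
    finally show "dl \<mu> f x = 0" .
  qed
  define e where "e = (\<lambda>x. exp (\<mu> * complex_of_real x))"
  have sme: "smooth e" unfolding e_def by (rule smooth_exp)
  have dle: "dl \<mu> e = (\<lambda>_. 0)"
    unfolding dl_def e_def has_vector_derivative_imp_Dx[OF has_vector_derivative_exp_mult] by simp
  have "(\<lambda>x. 1 * f x + (- 1) * e x) = (\<lambda>_. 0)"
  proof (rule dl_eq_zero_imp_zero)
    show "smooth (\<lambda>x. 1 * f x + (- 1) * e x)" by (rule smooth_lincomb[OF smf sme])
    show "dl \<mu> (\<lambda>x. 1 * f x + (- 1) * e x) = (\<lambda>_. 0)"
      unfolding dl_lincomb[OF smf sme] dlf dle by simp
    have "P (Suc k) a = 0" if "k < m" for k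
      using bern_vanish_left[OF d, of "Suc k"] that unfolding vanish_def P_def m_def
      by (metis Dn.simps(1) Suc_mono length_Cons zero_less_Suc)
    moreover have "P 0 a = 1" using bern_left[OF d, of 0] by (simp add: P_def)
    moreover have "\<mu> = complex_of_real (Re \<mu>)" using \<mu> by (simp add: complex_eq_iff)
    then have "e a = complex_of_real (c 0)" unfolding e_def c0 by (metis exp_of_real of_real_mult)
    ultimately show "1 * f a + (- 1) * e a = 0"
      by (simp add: f_def sum.lessThan_Suc_shift del: sum.lessThan_Suc)
  qed
  then show ?thesis by (simp add: fun_eq_iff f_def e_def P_def m_def)
qed

lemma bern_ratio_tendsto:
  assumes "disconj a b \<mu>s" "disconj a b \<nu>s" "length \<mu>s = length \<nu>s" "k < length \<nu>s"
  shows "((\<lambda>x. bern \<mu>s a b k x / bern \<nu>s a b k x)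
    \<longlongrightarrow> complex_of_real (lead a b \<mu>s k / lead a b \<nu>s k)) (at_left b)"
proof -
  define r where "r = length \<nu>s - 1 - k"
  have k: "k < length \<mu>s" "r = length \<mu>s - 1 - k" using assms by (auto simp: r_def)
  have "((\<lambda>x. bern \<mu>s a b k x / bern \<nu>s a b k x)
      \<longlongrightarrow> Dn r (bern \<mu>s a b k) b / Dn r (bern \<nu>s a b k) b) (at b)"
    using bern_spec[OF assms(1) k(1)] bern_spec[OF assms(2,4)] k(2) r_def
    by (intro tendsto_ratio bern_smooth[OF assms(1) k(1)] bern_smooth[OF assms(2,4)]) auto
  then show ?thesis
    unfolding bern_right_eq_lead[OF assms(1) k] bern_right_eq_lead[OF assms(2,4) r_def]
    by (simp add: filterlim_at_split)
qed

section \<open>Comparison of leading coefficients and linear independence\<close>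

text \<open>This is what makes the nodes increase strictly. The sign of \<open>s\<close> in q0 - q1
  = s p decides the comparison; it is found by computing an r-th derivative at b in two ways, the
  top index being treated apart.\<close>

lemma lead_less:
  assumes d: "disconj a b (\<mu>0 # \<mu>1 # \<nu>s)" and im: "Im \<mu>0 = 0" "Im \<mu>1 = 0" and less: "Re \<mu>0 < Re \<mu>1"
    and k: "k < Suc (length \<nu>s)"
  shows "lead a b (\<mu>0 # \<nu>s) k / lead a b (\<mu>1 # \<nu>s) k < 1"
proof -
  have d1: "disconj a b (\<mu>1 # \<nu>s)" using disconj_real_tail[OF d im(1)] .
  have "disconj a b (\<mu>1 # \<mu>0 # \<nu>s)" using d disconj_mset_cong[of "\<mu>0 # \<mu>1 # \<nu>s" "\<mu>1 # \<mu>0 # \<nu>s"] by simp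
  then have d0: "disconj a b (\<mu>0 # \<nu>s)" using disconj_real_tail im(2) by blast
  have dn: "disconj a b \<nu>s" using disconj_real_tail[OF d1 im(2)] .
  define r where "r = length \<nu>s - k"
  define p q0 q1 where "p = bern (\<mu>0 # \<mu>1 # \<nu>s) a b (Suc k)"
    and "q0 = bern (\<mu>0 # \<nu>s) a b k" and "q1 = bern (\<mu>1 # \<nu>s) a b k"
  have l: "k < length (\<mu>0 # \<nu>s)" "k < length (\<mu>1 # \<nu>s)" "Suc k < length (\<mu>0 # \<mu>1 # \<nu>s)"
      "r = length (\<mu>0 # \<nu>s) - 1 - k" "r = length (\<mu>1 # \<nu>s) - 1 - k"
      "r = length (\<mu>0 # \<mu>1 # \<nu>s) - 1 - Suc k"
    using k by (auto simp: r_def)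
  note B0 = bern_spec[OF d0 l(1), folded q0_def l(4)]
  note B1 = bern_spec[OF d1 l(2), folded q1_def l(5)]
  note Bp = bern_spec[OF d l(3), folded p_def l(6)]
  note L = bern_right_eq_lead[OF d0 l(1,4), folded q0_def]
    bern_right_eq_lead[OF d1 l(2,5), folded q1_def] bern_right_eq_lead[OF d l(3,6), folded p_def]
  have sm: "smooth q0" "smooth q1" "smooth p" using B0 B1 Bp Espace_smooth by blast+
  define g where "g = (\<lambda>x. q0 x - q1 x)"
  have Dg: "Dn j g x = Dn j q0 x - Dn j q1 x" for j x
    unfolding g_def smooth_diff(2)[OF sm(1,2)] by simp
  have "q1 \<in> Espace (\<mu>0 # \<mu>1 # \<nu>s)" using Espace_mono_Cons B1(1) by blast
  moreover have "q0 \<in> Espace (\<mu>1 # \<mu>0 # \<nu>s)" using Espace_mono_Cons B0(1) by blast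
  then have "q0 \<in> Espace (\<mu>0 # \<mu>1 # \<nu>s)"
    using Espace_mset_cong[of "\<mu>0 # \<mu>1 # \<nu>s" "\<mu>1 # \<mu>0 # \<nu>s"] by simp
  ultimately have g: "g \<in> Espace (\<mu>0 # \<mu>1 # \<nu>s)" unfolding g_def by (intro Espace_diff)
  \<comment> \<open>Equal normalisations at a give the difference one further order there.\<close>
  have ga: "vanish g a (Suc k)" and gb: "vanish g b r"
    using B0 B1 by (auto simp: vanish_def Dg less_Suc_eq)
  define s where "s = Dn (Suc k) g a"
  have gs: "g = (\<lambda>x. s * p x)"
    unfolding s_def p_def using gb by (intro vanish_imp_bern_multiple[OF d g l(3) ga]) (simp add: r_def)
  have gr: "Dn r g b = s * complex_of_real (lead a b (\<mu>0 # \<mu>1 # \<nu>s) (Suc k))"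
    unfolding gs smooth_scale(2)[OF sm(3)] L(3) by simp
  have Ims: "Im s = 0"
    unfolding s_def Dg q0_def q1_def using Dn_bern_real[OF d0 l(1)] Dn_bern_real[OF d1 l(2)]
    by (simp del: Dn.simps(2))
  define h where "h = (\<lambda>x. dl \<mu>0 q0 x - dl \<mu>1 q1 x)"
  have h: "h \<in> Espace \<nu>s"
    unfolding h_def using Espace_dl[OF B0(1)] Espace_dl[OF B1(1)] by (intro Espace_diff)
  have Dh: "Dn j h x = Dn (Suc j) g x - \<mu>0 * Dn j q0 x + \<mu>1 * Dn j q1 x" for j x
    unfolding h_def smooth_diff(2)[OF smooth_dl(1)[OF sm(1)] smooth_dl(1)[OF sm(2)]]
      smooth_dl(2)[OF sm(1)] smooth_dl(2)[OF sm(2)] Dg by simp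
  have ha: "vanish h a k"
    using ga B0(2) B1(2) unfolding vanish_def Dh by (auto simp del: Dn.simps(2))
  have hk: "Dn k h a = s - \<mu>0 + \<mu>1"
    unfolding Dh B0(3) B1(3) s_def by simp
  have "Re s < 0"
  proof (cases "k < length \<nu>s")
    \<comment> \<open>For k = length \<open>\<nu>s\<close> the order of \<open>h\<close> at a
      reaches the dimension, so \<open>h\<close> is zero and s = \<mu>0 - \<mu>1.\<close>
    case False
    then have "h = (\<lambda>_. 0)" using Espace_vanish_imp_zero[OF h vanish_mono[OF ha]] by simp
    then have "s - \<mu>0 + \<mu>1 = 0" using hk by (simp add: Dn_zero)
    then have "Re s - Re \<mu>0 + Re \<mu>1 = 0" by (metis minus_complex.sel(1) plus_complex.sel(1) zero_complex.sel(1))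
    then show ?thesis using less by simp
  next
    case True
    define r' where "r' = length \<nu>s - 1 - k"
    have r': "r = Suc r'" using True by (simp add: r_def r'_def)
    have "vanish h b r'"
      using gb B0(4) B1(4) unfolding vanish_def Dh r' by (auto simp del: Dn.simps(2))
    then have hx: "h = (\<lambda>x. (s - \<mu>0 + \<mu>1) * bern \<nu>s a b k x)"
      unfolding hk[symmetric] r'_def by (rule vanish_imp_bern_multiple[OF dn h True ha])
    have "Dn r' h b = (s - \<mu>0 + \<mu>1) * complex_of_real (lead a b \<nu>s k)"
      by (subst hx) (simp add: smooth_scale(2)[OF bern_smooth[OF dn True]] bern_right_eq_lead[OF dn True r'_def])
    \<comment> \<open>\<open>q0\<close> and \<open>q1\<close> vanish at b to order r = r' + 1, so
      only the derivative of \<open>g\<close> survives.\<close>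
    moreover have "Dn r' h b = Dn r g b"
      using B0(4) B1(4) unfolding Dh by (simp add: r' vanish_def del: Dn.simps(2))
    ultimately have "(s - \<mu>0 + \<mu>1) * complex_of_real (lead a b \<nu>s k)
        = s * complex_of_real (lead a b (\<mu>0 # \<mu>1 # \<nu>s) (Suc k))"
      using gr by simp
    from arg_cong[OF this, of Re]
    have eq: "(Re s - Re \<mu>0 + Re \<mu>1) * lead a b \<nu>s k = Re s * lead a b (\<mu>0 # \<mu>1 # \<nu>s) (Suc k)"
      using Ims im by simp
    \<comment> \<open>\<open>w\<close> is negative because the two orders at b differ by one; hence
      in s (1 - w) = \<mu>0 - \<mu>1 < 0 the factor 1 - w is positive.\<close>
    define w where "w = lead a b (\<mu>0 # \<mu>1 # \<nu>s) (Suc k) / lead a b \<nu>s k"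
    have "w < 0" unfolding w_def using True by (intro lead_div_neg d dn) auto
    have "Re s - Re \<mu>0 + Re \<mu>1 = Re s * w"
      using eq lead_nonzero[OF dn True] by (simp add: w_def field_simps)
    then have "Re s * (1 - w) = Re \<mu>0 - Re \<mu>1" by (simp add: algebra_simps)
    then have "Re s * (1 - w) < 0" using less by simp
    then show ?thesis using \<open>w < 0\<close> by (simp add: mult_less_0_iff)
  qed
  \<comment> \<open>The r-th derivative of \<open>g\<close> at b writes the ratio as 1 plus s times
    a quotient that is positive, both orders at b being r.\<close>
  have "complex_of_real (lead a b (\<mu>0 # \<nu>s) k) - complex_of_real (lead a b (\<mu>1 # \<nu>s) k)
      = s * complex_of_real (lead a b (\<mu>0 # \<mu>1 # \<nu>s) (Suc k))"
    using gr unfolding Dg L .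
  from arg_cong[OF this, of Re]
  have "lead a b (\<mu>0 # \<nu>s) k = lead a b (\<mu>1 # \<nu>s) k + Re s * lead a b (\<mu>0 # \<mu>1 # \<nu>s) (Suc k)"
    using Ims by simp
  then have "lead a b (\<mu>0 # \<nu>s) k / lead a b (\<mu>1 # \<nu>s) k
      = 1 + Re s * (lead a b (\<mu>0 # \<mu>1 # \<nu>s) (Suc k) / lead a b (\<mu>1 # \<nu>s) k)"
    using lead_nonzero[OF d1 l(2)] by (simp add: field_simps)
  moreover have "lead a b (\<mu>0 # \<mu>1 # \<nu>s) (Suc k) / lead a b (\<mu>1 # \<nu>s) k > 0"
    using k by (intro lead_div_pos d d1) auto
  then have "Re s * (lead a b (\<mu>0 # \<mu>1 # \<nu>s) (Suc k) / lead a b (\<mu>1 # \<nu>s) k) < 0"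
    by (rule mult_neg_pos[OF \<open>Re s < 0\<close>])
  ultimately show ?thesis by linarith
qed

text \<open>Linear independence on [a,b], needed for uniqueness of nodes and weights. The sum
  vanishes on an interval, hence everywhere, and its derivatives at a form a triangular system for
  the coefficients.\<close>

lemma bern_sum_eq_zero:
  assumes d: "disconj a b \<mu>s"
    and zero: "\<And>x. x \<in> {a..b} \<Longrightarrow> (\<Sum>k<length \<mu>s. \<gamma> k * bern \<mu>s a b k x) = 0"
    and k: "k < length \<mu>s"
  shows "\<gamma> k = 0"
proof -
  define f where "f = (\<lambda>x. \<Sum>k<length \<mu>s. \<gamma> k * bern \<mu>s a b k x)"
  have f: "f \<in> Espace \<mu>s" unfolding f_def using bern_in_Espace[OF d] by (rule Espace_sum)
  have ab: "a < b" using d by (simp add: disconj_def)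
  \<comment> \<open>Interior points are taken because \<open>Dn\<close> uses two-sided derivatives
    and nothing is known yet about \<open>f\<close> outside [a,b].\<close>
  have int: "Dn j f x = 0" if "x \<in> {a<..<b}" for j x
    using that
  proof (induction j arbitrary: x)
    case 0
    then show ?case using zero by (simp add: f_def)
  next
    case (Suc j)
    have "(Dn j f has_vector_derivative 0) (at x)"
    proof (rule has_vector_derivative_transform_within_open[of "\<lambda>_. 0"])
      show "open {a<..<b}" by simp
    qed (use Suc in auto)
    then show ?case by (simp add: Dx_def vector_derivative_at)
  qed
  have "f = (\<lambda>_. 0)"
    using int[of "(a + b) / 2"] ab
    by (intro Espace_vanish_imp_zero[OF f, of "(a + b) / 2"]) (simp add: vanish_def)
  then have "Dn j f a = 0" for j by (simp add: Dn_zero)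
  moreover have "Dn j f = (\<lambda>x. \<Sum>i<length \<mu>s. \<gamma> i * Dn j (bern \<mu>s a b i) x)" for j
    using smooth_sum[of "length \<mu>s" "bern \<mu>s a b" \<gamma>] bern_smooth[OF d] unfolding f_def by blast
  ultimately have D0: "(\<Sum>i<length \<mu>s. \<gamma> i * Dn j (bern \<mu>s a b i) a) = 0" for j by simp
  show ?thesis using k
  proof (induction k rule: less_induct)
    case (less k)
    have "(\<Sum>i<length \<mu>s. \<gamma> i * Dn k (bern \<mu>s a b i) a) = (\<Sum>i<length \<mu>s. if i = k then \<gamma> k else 0)"
    proof (rule sum.cong[OF refl])
      fix i assume "i \<in> {..<length \<mu>s}"
      then have i: "i < length \<mu>s" by simp
      consider "i < k" | "i = k" | "k < i" by linarith
      then show "\<gamma> i * Dn k (bern \<mu>s a b i) a = (if i = k then \<gamma> k else 0)"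
      proof cases
        case 1
        then show ?thesis using less.IH i by simp
      next
        case 2
        then show ?thesis using bern_left[OF d i] by simp
      next
        case 3
        then show ?thesis using bern_vanish_left[OF d i] by (simp add: vanish_def)
      qed
    qed
    then show ?case using D0[of k] less.prems by simp
  qed
qed

section \<open>Nodes, weights and uniqueness of the operator\<close>

theorem mainTheorem15:
  fixes lam :: "nat \<Rightarrow> complex" and n :: nat and a b :: real
  assumes "n \<ge> 1"
    and "lam 0 \<in> \<real>" and "lam 1 \<in> \<real>" and "Re (lam 0) < Re (lam 1)"
    and "closed_cnj (map lam [0..<n+1])"
    and "0 < b - a"
    and "(MAX j\<in>{0..n}. \<bar>Im (lam j)\<bar>) = 0 \<or>
         b - a < pi / (MAX j\<in>{0..n}. \<bar>Im (lam j)\<bar>)"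
  shows
    "(\<forall>k\<in>{1..n}. \<exists>c::real. c > 0 \<and>
        ((\<lambda>x. bern (map lam (0 # [2..<n+1])) a b (k-1) x
              / bern (map lam [1..<n+1]) a b (k-1) x) \<longlongrightarrow> complex_of_real c) (at_left b))
   \<and> (\<forall>l<n. \<exists>c. ((\<lambda>x. Dx (bern (map lam [0..<n+1]) a b l) x
              / bern (map lam [1..<n+1]) a b l x) \<longlongrightarrow> c) (at_left b))
   \<and> (\<forall>t :: nat \<Rightarrow> real.
        t 0 = a \<and>
        (\<forall>k\<in>{1..n}. complex_of_real (exp ((Re (lam 0) - Re (lam 1)) * (t k - t (k-1))))
            = Lim (at_left b) (\<lambda>x. bern (map lam (0 # [2..<n+1])) a b (k-1) x
                                   / bern (map lam [1..<n+1]) a b (k-1) x))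
      \<longrightarrow>
        (\<forall>\<alpha> :: nat \<Rightarrow> complex.
          \<alpha> 0 = 1 \<and>
          (\<forall>k\<in>{1..n}. \<alpha> k = exp (- lam 0 * complex_of_real (t k - a)) * (-1) ^ k *
              (\<Prod>l<k. Lim (at_left b) (\<lambda>x. Dx (bern (map lam [0..<n+1]) a b l) x
                                             / bern (map lam [1..<n+1]) a b l x)))
        \<longrightarrow>
          (\<forall>k<n. t k < t (Suc k)) \<and> t n = b
          \<and> (\<forall>k\<le>n. \<alpha> k \<in> \<real> \<and> Re (\<alpha> k) > 0)
          \<and> (\<forall>x\<in>{a..b}. (\<Sum>k\<le>n. \<alpha> k * exp (lam 0 * complex_of_real (t k))
                   * bern (map lam [0..<n+1]) a b k x) = exp (lam 0 * complex_of_real x))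
          \<and> (\<forall>x\<in>{a..b}. (\<Sum>k\<le>n. \<alpha> k * exp (lam 1 * complex_of_real (t k))
                   * bern (map lam [0..<n+1]) a b k x) = exp (lam 1 * complex_of_real x))
          \<and> (\<forall>(s :: nat \<Rightarrow> real) (\<beta> :: nat \<Rightarrow> real).
               (\<forall>x\<in>{a..b}. (\<Sum>k\<le>n. complex_of_real (\<beta> k) * exp (lam 0 * complex_of_real (s k))
                   * bern (map lam [0..<n+1]) a b k x) = exp (lam 0 * complex_of_real x))
             \<and> (\<forall>x\<in>{a..b}. (\<Sum>k\<le>n. complex_of_real (\<beta> k) * exp (lam 1 * complex_of_real (s k))
                   * bern (map lam [0..<n+1]) a b k x) = exp (lam 1 * complex_of_real x))
             \<longrightarrow> (\<forall>k\<le>n. s k = t k \<and> complex_of_real (\<beta> k) = \<alpha> k))))"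
proof -
  define l0 l1 where "l0 = Re (lam 0)" and "l1 = Re (lam 1)"
  have im: "Im (lam 0) = 0" "Im (lam 1) = 0" using assms(2,3) by (auto simp: complex_is_Real_iff)
  have l0: "lam 0 = complex_of_real l0" and l1: "lam 1 = complex_of_real l1"
    using im by (simp_all add: l0_def l1_def complex_eq_iff)
  have ll: "l0 < l1" using assms(4) by (simp add: l0_def l1_def)
  \<comment> \<open>The exponents from index 2 on; the list is empty for n = 1.\<close>
  define \<nu>s where "\<nu>s = map lam [2..<n+1]"
  have len: "Suc (length \<nu>s) = n" using assms(1) by (simp add: \<nu>s_def del: upt_Suc)
  have lists: "map lam [0..<n+1] = lam 0 # lam 1 # \<nu>s" "map lam [1..<n+1] = lam 1 # \<nu>s"
      "map lam (0 # [2..<n+1]) = lam 0 # \<nu>s"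
    using assms(1) by (auto simp: \<nu>s_def upt_conv_Cons numeral_2_eq_2 simp del: upt_Suc)
  have d: "disconj a b (lam 0 # lam 1 # \<nu>s)"
  proof -
    define M where "M = (MAX j\<in>{0..n}. \<bar>Im (lam j)\<bar>)"
    have M: "\<bar>Im (lam j)\<bar> \<le> M" if "j \<le> n" for j unfolding M_def using that by (intro Max_ge) auto
    have "0 \<le> M" using M[of 0] by linarith
    then have "M * (b - a) < pi"
      using assms(7)[folded M_def] pi_gt_zero by (cases "M = 0") (auto simp: field_simps)
    moreover have "\<bar>Im (lam j)\<bar> * (b - a) \<le> M * (b - a)" if "j \<le> n" for j
      using M[OF that] assms(6) by (intro mult_right_mono) auto
    ultimately have "\<bar>Im (lam j)\<bar> * (b - a) < pi" if "j \<le> n" for j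
      using that by (meson le_less_trans)
    then have "disconj a b (map lam [0..<n+1])"
      using closed_cnj_imp_mset[OF assms(5)] assms(6) by (auto simp: disconj_def)
    then show ?thesis by (simp only: lists)
  qed
  \<comment> \<open>Exchanging the two real exponents makes the results about the head exponent
    available for \<open>lam 1\<close> as well.\<close>
  have swap: "mset (lam 0 # lam 1 # \<nu>s) = mset (lam 1 # lam 0 # \<nu>s)" by simp
  have d': "disconj a b (lam 1 # lam 0 # \<nu>s)" using d disconj_mset_cong[OF swap] by blast
  have d1: "disconj a b (lam 1 # \<nu>s)" using disconj_real_tail[OF d im(1)] .
  have d0: "disconj a b (lam 0 # \<nu>s)" using disconj_real_tail[OF d' im(2)] .
  define P where "P = bern (lam 0 # lam 1 # \<nu>s) a b"
  define LP where "LP = lead a b (lam 0 # lam 1 # \<nu>s)"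
  define L1 where "L1 = lead a b (lam 1 # \<nu>s)"
  define L0 where "L0 = lead a b (lam 0 # \<nu>s)"
  have nz: "L0 k \<noteq> 0" "L1 k \<noteq> 0" if "k < n" for k
    using lead_nonzero[OF d0] lead_nonzero[OF d1] that len by (auto simp: L0_def L1_def)
  have nzP: "LP k \<noteq> 0" if "k \<le> n" for k
    using lead_nonzero[OF d] that len by (auto simp: LP_def)
  have rho: "0 < L0 k / L1 k" "L0 k / L1 k < 1" if "k < n" for k
    using lead_div_pos[OF d0 _ d1, of k k] lead_less[OF d im assms(4), of k] that len
    by (auto simp: L0_def L1_def)
  have neg: "LP k / L1 k < 0" if "k < n" for k
    using lead_div_neg[OF d _ d1, of k k] that len by (auto simp: LP_def L1_def Suc_diff_le)
  have lim1: "((\<lambda>x. bern (lam 0 # \<nu>s) a b k x / bern (lam 1 # \<nu>s) a b k x)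
      \<longlongrightarrow> complex_of_real (L0 k / L1 k)) (at_left b)" if "k < n" for k
    using bern_ratio_tendsto[OF d0 d1, of k] that len by (auto simp: L0_def L1_def)
  have lim2: "((\<lambda>x. Dx (P k) x / bern (lam 1 # \<nu>s) a b k x)
      \<longlongrightarrow> complex_of_real (LP k / L1 k)) (at_left b)" if "k < n" for k
    using Dx_bern_ratio_tendsto[OF d im(1), of k] that len by (auto simp: LP_def L1_def P_def)
  \<comment> \<open>Solutions of the recursion in \<open>exp_bern_expansion\<close> for the two
    exponentials. Stripping \<open>lam 0\<close> leaves the tail with leading coefficients
    \<open>L1\<close>, stripping \<open>lam 1\<close> the one with \<open>L0\<close>.\<close>
  define c0 c1 where "c0 = (\<lambda>k. exp (l0 * a) * (\<Prod>l<k. - (LP l / L1 l)))"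
    and "c1 = (\<lambda>k. exp (l1 * a) * (\<Prod>l<k. - (LP l / L0 l)))"
  have expand0: "(\<Sum>k<Suc n. complex_of_real (c0 k) * P k x) = exp (lam 0 * complex_of_real x)" for x
    using exp_bern_expansion[OF d im(1), of c0 x] len
    by (simp add: c0_def l0_def LP_def L1_def P_def)
  have expand1: "(\<Sum>k<Suc n. complex_of_real (c1 k) * P k x) = exp (lam 1 * complex_of_real x)" for x
    using exp_bern_expansion[OF d' im(2), of c1 x] len bern_mset_cong[OF swap] lead_mset_cong[OF swap]
    by (simp add: c1_def l1_def LP_def L0_def P_def)
  have c0_pos: "c0 k > 0" if "k \<le> n" for k
    unfolding c0_def using neg that by (intro mult_pos_pos prod_pos) force+
  have c1_nz: "c1 k \<noteq> 0" if "k \<le> n" for k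
    unfolding c1_def using nz nzP that by (auto simp: prod_zero_iff)
  \<comment> \<open>The quotient of \<open>c0\<close> by \<open>c1\<close> is, up to the initial
    factor, the product of the ratios that define the nodes.\<close>
  have c01: "c0 k = c1 k * (exp ((l0 - l1) * a) * (\<Prod>l<k. L0 l / L1 l))" if "k \<le> n" for k
  proof -
    have "- (LP l / L1 l) = - (LP l / L0 l) * (L0 l / L1 l)" if "l < k" for l
      using nz[of l] that \<open>k \<le> n\<close> by simp
    then have "(\<Prod>l<k. - (LP l / L1 l)) = (\<Prod>l<k. - (LP l / L0 l) * (L0 l / L1 l))"
      by (intro prod.cong) auto
    also have "\<dots> = (\<Prod>l<k. - (LP l / L0 l)) * (\<Prod>l<k. L0 l / L1 l)" by (rule prod.distrib)
    finally have e: "(\<Prod>l<k. - (LP l / L1 l)) = (\<Prod>l<k. - (LP l / L0 l)) * (\<Prod>l<k. L0 l / L1 l)" .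
    have "exp (l0 * a) = exp (l1 * a) * exp ((l0 - l1) * a)"
      by (simp add: algebra_simps flip: exp_add)
    then show ?thesis unfolding c0_def c1_def e by simp
  qed
  \<comment> \<open>At b only the basis function of index n survives; this will give
    \<open>t n = b\<close>.\<close>
  have Pb: "P k b = 0" if "k < n" for k
    using bern_vanish_right[OF d, of k] that len unfolding vanish_def P_def
    by (auto dest: spec[of _ 0])
  have Pn: "P n b \<noteq> 0" using bern_right[OF d, of n] len by (simp add: P_def)
  \<comment> \<open>The claim with all limits already evaluated as quotients of leading
    coefficients.\<close>
  have main: "(\<forall>k<n. t k < t (Suc k)) \<and> t n = b
      \<and> (\<forall>k\<le>n. \<alpha> k \<in> \<real> \<and> Re (\<alpha> k) > 0)
      \<and> (\<forall>x\<in>{a..b}. (\<Sum>k\<le>n. \<alpha> k * exp (lam 0 * complex_of_real (t k)) * P k x) = exp (lam 0 * complex_of_real x))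
      \<and> (\<forall>x\<in>{a..b}. (\<Sum>k\<le>n. \<alpha> k * exp (lam 1 * complex_of_real (t k)) * P k x) = exp (lam 1 * complex_of_real x))
      \<and> (\<forall>(s :: nat \<Rightarrow> real) (\<beta> :: nat \<Rightarrow> real).
               (\<forall>x\<in>{a..b}. (\<Sum>k\<le>n. complex_of_real (\<beta> k) * exp (lam 0 * complex_of_real (s k)) * P k x) = exp (lam 0 * complex_of_real x))
             \<and> (\<forall>x\<in>{a..b}. (\<Sum>k\<le>n. complex_of_real (\<beta> k) * exp (lam 1 * complex_of_real (s k)) * P k x) = exp (lam 1 * complex_of_real x))
             \<longrightarrow> (\<forall>k\<le>n. s k = t k \<and> complex_of_real (\<beta> k) = \<alpha> k))"
    if t0: "t 0 = a"
      and t: "\<And>k. k < n \<Longrightarrow> exp ((l0 - l1) * (t (Suc k) - t k)) = L0 k / L1 k"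
      and \<alpha>: "\<And>k. k \<le> n \<Longrightarrow> \<alpha> k = exp (- lam 0 * complex_of_real (t k - a)) * (- 1) ^ k
          * (\<Prod>l<k. complex_of_real (LP l / L1 l))"
    for t :: "nat \<Rightarrow> real" and \<alpha> :: "nat \<Rightarrow> complex"
  proof -
    \<comment> \<open>Real form of the weights, forced by
      \<open>A k * exp (l0 * t k) = c0 k\<close>.\<close>
    define A where "A = (\<lambda>k. exp (- l0 * t k) * c0 k)"
    have \<alpha>A: "\<alpha> k = complex_of_real (A k)" if "k \<le> n" for k
    proof -
      have "(\<Prod>l<k. - (LP l / L1 l)) = (- 1) ^ k * (\<Prod>l<k. LP l / L1 l)"
        using prod.distrib[of "\<lambda>_. - 1" "\<lambda>l. LP l / L1 l" "{..<k}"] by simp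
      moreover have "exp (- l0 * t k) * exp (l0 * a) = exp (- l0 * (t k - a))"
        by (simp add: algebra_simps flip: exp_add)
      ultimately have "A k = exp (- l0 * (t k - a)) * ((- 1) ^ k * (\<Prod>l<k. LP l / L1 l))"
        unfolding A_def c0_def by (metis mult.assoc)
      then show ?thesis
        unfolding \<alpha>[OF that] l0 by (simp flip: exp_of_real)
    qed
    have prod_t: "exp ((l0 - l1) * (t k - a)) = (\<Prod>l<k. L0 l / L1 l)" if "k \<le> n" for k
      using that
    proof (induction k)
      case 0
      then show ?case by (simp add: t0)
    next
      case (Suc k)
      have "exp ((l0 - l1) * (t (Suc k) - a))
          = exp ((l0 - l1) * (t k - a)) * exp ((l0 - l1) * (t (Suc k) - t k))"
        by (simp add: algebra_simps flip: exp_add)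
      also have "\<dots> = (\<Prod>l<k. L0 l / L1 l) * (L0 k / L1 k)"
        using Suc t[of k] by simp
      finally show ?case by simp
    qed
    \<comment> \<open>The link between nodes and coefficients: it makes the same weights reproduce
      the second exponential, and it also drives \<open>t n = b\<close> and uniqueness.\<close>
    have c01t: "c0 k = c1 k * exp ((l0 - l1) * t k)" if "k \<le> n" for k
    proof -
      have "exp ((l0 - l1) * a) * exp ((l0 - l1) * (t k - a)) = exp ((l0 - l1) * t k)"
        by (simp add: algebra_simps flip: exp_add)
      then show ?thesis using c01[OF that] unfolding prod_t[OF that, symmetric] by simp
    qed
    have A0: "A k * exp (l0 * t k) = c0 k" for k
      unfolding A_def by (simp add: exp_minus)
    have A1: "A k * exp (l1 * t k) = c1 k" if "k \<le> n" for k
    proof -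
      have "exp (- l0 * t k) * exp ((l0 - l1) * t k) * exp (l1 * t k) = 1"
        by (simp add: algebra_simps flip: exp_add)
      then show ?thesis unfolding A_def c01t[OF that] by (simp add: mult_ac)
    qed
    have "t k < t (Suc k)" if "k < n" for k
    proof -
      have "exp ((l0 - l1) * (t (Suc k) - t k)) < 1" using t[OF that] rho(2)[OF that] by simp
      then have "(l0 - l1) * (t (Suc k) - t k) < 0" by simp
      then show ?thesis using ll by (simp add: mult_less_0_iff)
    qed
    moreover have "t n = b"
    proof -
      \<comment> \<open>Evaluating both expansions at b and eliminating \<open>P n b\<close> leaves
        one equation for \<open>t n\<close>.\<close>
      have e: "complex_of_real (c0 n) * P n b = exp (lam 0 * complex_of_real b)"
        "complex_of_real (c1 n) * P n b = exp (lam 1 * complex_of_real b)"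
        using expand0[of b] expand1[of b] Pb by simp_all
      have "complex_of_real (c0 n) * exp (lam 1 * complex_of_real b) * P n b
          = complex_of_real (c1 n) * exp (lam 0 * complex_of_real b) * P n b"
        unfolding e[symmetric] by (simp add: mult_ac)
      then have "complex_of_real (c0 n * exp (l1 * b)) = complex_of_real (c1 n * exp (l0 * b))"
        using Pn by (simp add: l0 l1[simplified] flip: exp_of_real)
      then have "c1 n * (exp ((l0 - l1) * t n) * exp (l1 * b)) = c1 n * exp (l0 * b)"
        unfolding of_real_eq_iff c01t[OF order_refl] by (simp add: mult_ac)
      then have "exp ((l0 - l1) * t n + l1 * b) = exp (l0 * b)"
        using c1_nz[of n] by (simp flip: exp_add)
      then have "(l0 - l1) * t n = (l0 - l1) * b" by (simp add: algebra_simps)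
      then show ?thesis using ll by simp
    qed
    moreover have "\<alpha> k \<in> \<real> \<and> Re (\<alpha> k) > 0" if "k \<le> n" for k
      using c0_pos[OF that] by (simp add: \<alpha>A[OF that] A_def)
    moreover have "(\<Sum>k\<le>n. \<alpha> k * exp (lam 0 * complex_of_real (t k)) * P k x) = exp (lam 0 * complex_of_real x)" for x
    proof -
      have "\<alpha> k * exp (lam 0 * complex_of_real (t k)) = complex_of_real (c0 k)" if "k \<le> n" for k
        unfolding \<alpha>A[OF that] l0 A0[symmetric] by (simp flip: exp_of_real)
      then have "(\<Sum>k\<le>n. \<alpha> k * exp (lam 0 * complex_of_real (t k)) * P k x)
          = (\<Sum>k\<le>n. complex_of_real (c0 k) * P k x)"
        by (intro sum.cong) auto
      then show ?thesis using expand0[of x] by (simp only: lessThan_Suc_atMost)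
    qed
    moreover have "(\<Sum>k\<le>n. \<alpha> k * exp (lam 1 * complex_of_real (t k)) * P k x) = exp (lam 1 * complex_of_real x)" for x
    proof -
      have "\<alpha> k * exp (lam 1 * complex_of_real (t k)) = complex_of_real (c1 k)" if "k \<le> n" for k
        unfolding \<alpha>A[OF that] l1 A1[OF that, symmetric] by (simp flip: exp_of_real)
      then have "(\<Sum>k\<le>n. \<alpha> k * exp (lam 1 * complex_of_real (t k)) * P k x)
          = (\<Sum>k\<le>n. complex_of_real (c1 k) * P k x)"
        by (intro sum.cong) auto
      then show ?thesis using expand1[of x] by (simp only: lessThan_Suc_atMost)
    qed
    moreover have "s k = t k \<and> complex_of_real (\<beta> k) = \<alpha> k"
      if s0: "\<forall>x\<in>{a..b}. (\<Sum>k\<le>n. complex_of_real (\<beta> k) * exp (lam 0 * complex_of_real (s k)) * P k x) = exp (lam 0 * complex_of_real x)"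
        and s1: "\<forall>x\<in>{a..b}. (\<Sum>k\<le>n. complex_of_real (\<beta> k) * exp (lam 1 * complex_of_real (s k)) * P k x) = exp (lam 1 * complex_of_real x)"
        and k: "k \<le> n"
      for s \<beta> :: "nat \<Rightarrow> real" and k
    proof -
      have coeff: "x k = complex_of_real (y k)"
        if "\<And>z. z \<in> {a..b} \<Longrightarrow> (\<Sum>k\<le>n. x k * P k z) = (\<Sum>k<Suc n. complex_of_real (y k) * P k z)"
        for x y
      proof -
        have "(\<Sum>k<length (lam 0 # lam 1 # \<nu>s). (x k - complex_of_real (y k)) * bern (lam 0 # lam 1 # \<nu>s) a b k z) = 0"
          if "z \<in> {a..b}" for z
          using \<open>\<And>z. z \<in> {a..b} \<Longrightarrow> _ z\<close>[OF that] len
          by (simp add: P_def lessThan_Suc_atMost left_diff_distrib sum_subtractf)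
        from bern_sum_eq_zero[OF d this, of k] show ?thesis using k len by simp
      qed
      have b0: "\<beta> k * exp (l0 * s k) = c0 k"
      proof -
        have "complex_of_real (\<beta> k) * exp (lam 0 * complex_of_real (s k)) = complex_of_real (c0 k)"
          using s0 expand0 by (intro coeff) simp
        then have "complex_of_real (\<beta> k * exp (l0 * s k)) = complex_of_real (c0 k)"
          by (simp add: l0 flip: exp_of_real)
        then show ?thesis by (simp only: of_real_eq_iff)
      qed
      have b1: "\<beta> k * exp (l1 * s k) = c1 k"
      proof -
        have "complex_of_real (\<beta> k) * exp (lam 1 * complex_of_real (s k)) = complex_of_real (c1 k)"
          using s1 expand1 by (intro coeff) simp
        then have "complex_of_real (\<beta> k * exp (l1 * s k)) = complex_of_real (c1 k)"
          by (simp add: l1[simplified] flip: exp_of_real)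
        then show ?thesis by (simp only: of_real_eq_iff)
      qed
      have "exp (l1 * s k) * exp ((l0 - l1) * s k) = exp (l0 * s k)"
        by (simp add: algebra_simps flip: exp_add)
      \<comment> \<open>The quotient of the two coefficient equations determines exp ((l0 - l1) s),
        which is injective in s since l0 < l1; the equation for \<open>l0\<close> then gives the
        weight.\<close>
      then have "c1 k * exp ((l0 - l1) * s k) = c0 k" using b0 b1 by (metis mult.assoc)
      then have "exp ((l0 - l1) * s k) = exp ((l0 - l1) * t k)"
        using c01t[OF k] c1_nz[OF k] by simp
      then have st: "s k = t k" using ll by simp
      then have "\<beta> k * exp (l0 * t k) = A k * exp (l0 * t k)" using b0 A0 by simp
      then show ?thesis using st \<alpha>A[OF k] by simp
    qed
    ultimately show ?thesis by blast
  qed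
  have Lim1: "Lim (at_left b) (\<lambda>x. bern (lam 0 # \<nu>s) a b k x / bern (lam 1 # \<nu>s) a b k x)
      = complex_of_real (L0 k / L1 k)" if "k < n" for k
    using lim1[OF that] by (intro tendsto_Lim) auto
  have Lim2: "Lim (at_left b) (\<lambda>x. Dx (P k) x / bern (lam 1 # \<nu>s) a b k x)
      = complex_of_real (LP k / L1 k)" if "k < n" for k
    using lim2[OF that] by (intro tendsto_Lim) auto
  have pos_lim: "\<forall>k\<in>{1..n}. \<exists>c::real. c > 0 \<and>
      ((\<lambda>x. bern (lam 0 # \<nu>s) a b (k-1) x / bern (lam 1 # \<nu>s) a b (k-1) x)
        \<longlongrightarrow> complex_of_real c) (at_left b)"
  proof
    fix k assume "k \<in> {1..n}"
    then have "k - 1 < n" by auto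
    from rho(1)[OF this] lim1[OF this]
    show "\<exists>c::real. c > 0 \<and> ((\<lambda>x. bern (lam 0 # \<nu>s) a b (k-1) x / bern (lam 1 # \<nu>s) a b (k-1) x)
        \<longlongrightarrow> complex_of_real c) (at_left b)" by blast
  qed
  have deriv_lim: "\<forall>l<n. \<exists>c. ((\<lambda>x. Dx (P l) x / bern (lam 1 # \<nu>s) a b l x) \<longlongrightarrow> c) (at_left b)"
    using lim2 by blast
  show ?thesis
    unfolding lists P_def[symmetric]
  proof (rule conjI[OF pos_lim conjI[OF deriv_lim]], intro allI impI, goal_cases)
    case (1 t \<alpha>)
    show ?case
    proof (rule main)
      show "t 0 = a" using 1(1) by blast
      show "exp ((l0 - l1) * (t (Suc k) - t k)) = L0 k / L1 k" if "k < n" for k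
      proof -
        have "complex_of_real (exp ((l0 - l1) * (t (Suc k) - t k))) = complex_of_real (L0 k / L1 k)"
          using bspec[OF conjunct2[OF 1(1)], of "Suc k"] that Lim1[OF that] by (simp add: l0_def l1_def)
        then show ?thesis by (simp only: of_real_eq_iff)
      qed
      show "\<alpha> k = exp (- lam 0 * complex_of_real (t k - a)) * (- 1) ^ k
          * (\<Prod>l<k. complex_of_real (LP l / L1 l))" if "k \<le> n" for k
      \<comment> \<open>The product formula is assumed only from k = 1 on; at k = 0 it agrees with
        \<open>\<alpha> 0 = 1\<close> because \<open>t 0 = a\<close>.\<close>
      proof (cases "k = 0")
        case True
        then show ?thesis using 1 by simp
      next
        case False
        have "(\<Prod>l<k. Lim (at_left b) (\<lambda>x. Dx (P l) x / bern (lam 1 # \<nu>s) a b l x))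
            = (\<Prod>l<k. complex_of_real (LP l / L1 l))"
          using that by (intro prod.cong refl Lim2) simp
        then show ?thesis using bspec[OF conjunct2[OF 1(2)], of k] that False by simp
      qed
    qed
  qed
qed

end
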